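(* Let $\mathcal{H}$ be a complete Pick space on a set $X$ whose reproducing kernel is normalized at $x_0 \in X$, and let $f \in \mathcal{H}$ with $\|f\|_{\mathcal{H}} \le 1$. Then there are $\varphi, \psi \in \mathrm{Mult}(\mathcal{H})$ with $\|\varphi\|_{\mathrm{Mult}(\mathcal{H})} \le 1$, $\|\psi\|_{\mathrm{Mult}(\mathcal{H})} \le 1$ and $\psi(x_0) = 0$ such that $$ f = \frac{\varphi}{1-\psi}. $$ In particular, $\mathcal{H} \subset N^+(\mathcal{H})$.
   Context: $\mathcal{H}$ is a reproducing kernel Hilbert space of complex-valued functions on a set $X$ with reproducing kernel $k$, and it is assumed that $k$ does not vanish on the diagonal. The multiplier algebra is $\mathrm{Mult}(\mathcal{H}) = \{\varphi : X \to \mathbb{C} : \varphi f \in \mathcal{H} \text{ for all } f \in \mathcal{H}\}$; each $\varphi \in \mathrm{Mult}(\mathcal{H})$ gives a bounded multiplication operator $M_\varphi$ on $\mathcal{H}$, and $\|\varphi\|_{\mathrm{Mult}(\mathcal{H})} = \|M_\varphi\|$. $\mathcal{H}$ (or $k$) is normalized at $x_0 \in X$ if $k(x,x_0) = 1$ for all $x \in X$. $\mathcal{H}$ is a complete Pick space if for every $r \in \mathbb{N}$ and every finite collection of points $z_1,\ldots,z_n \in X$ and matrices $W_1,\ldots,W_n \in M_r(\mathbb{C})$, positive semidefiniteness of the $nr \times nr$ block matrix $[k(z_i,z_j)(I_{\mathbb{C}^r} - W_i W_j^* )]_{i,j=1}^n$ implies that there exists $\Phi \in M_r(\mathrm{Mult}(\mathcal{H}))$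 of norm at most $1$ (as a multiplication operator on $\mathcal{H} \otimes \mathbb{C}^r$) with $\Phi(z_i) = W_i$ for $i=1,\ldots,n$. A multiplier $\psi$ is cyclic if $\psi\mathcal{H}$ is dense in $\mathcal{H}$ (such a $\psi$ vanishes nowhere on $X$). The Smirnov class of $\mathcal{H}$ is $N^+(\mathcal{H}) = \{\varphi/\psi : \varphi,\psi \in \mathrm{Mult}(\mathcal{H}) \text{ and } \psi \text{ is cyclic}\}$. *)

theory Defs
  imports
    "HOL-Library.Extended_Nonnegative_Real"
    "Jordan_Normal_Form.Schur_Decomposition"
begin

text \<open>
  A Hilbert space of complex-valued functions on the set \<open>X\<close>, represented by a type \<open>'x\<close>, is given
  by its carrier \<open>H\<close> together with an inner product \<open>ip\<close>, linear in the first argument, of which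
  only the values on \<open>H\<close> matter.
\<close>

definition hnorm :: "(('x \<Rightarrow> complex) \<Rightarrow> ('x \<Rightarrow> complex) \<Rightarrow> complex) \<Rightarrow> ('x \<Rightarrow> complex) \<Rightarrow> real" where
  "hnorm ip f = sqrt (Re (ip f f))"

text \<open>
  In \<open>ip_nonneg\<close>, as in \<open>psd_mat\<close> below, \<open>0 \<le> z\<close> for complex \<open>z\<close> says that \<open>z\<close> is real and nonnegative.
\<close>

locale rkhs =
  fixes H :: "('x \<Rightarrow> complex) set"
    and ip :: "('x \<Rightarrow> complex) \<Rightarrow> ('x \<Rightarrow> complex) \<Rightarrow> complex"
    and k :: "'x \<Rightarrow> 'x \<Rightarrow> complex"
  assumes zero_mem: "(\<lambda>x. 0) \<in> H"
    and add_mem: "f \<in> H \<Longrightarrow> g \<in> H \<Longrightarrow> (\<lambda>x. f x + g x) \<in> H"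
    and scale_mem: "f \<in> H \<Longrightarrow> (\<lambda>x. c * f x) \<in> H"
    and ip_add: "f \<in> H \<Longrightarrow> g \<in> H \<Longrightarrow> h \<in> H \<Longrightarrow> ip (\<lambda>x. f x + g x) h = ip f h + ip g h"
    and ip_scale: "f \<in> H \<Longrightarrow> h \<in> H \<Longrightarrow> ip (\<lambda>x. c * f x) h = c * ip f h"
    and ip_cnj: "f \<in> H \<Longrightarrow> g \<in> H \<Longrightarrow> ip g f = cnj (ip f g)"
    and ip_nonneg: "f \<in> H \<Longrightarrow> 0 \<le> ip f f"
    and ip_definite: "f \<in> H \<Longrightarrow> ip f f = 0 \<Longrightarrow> f = (\<lambda>x. 0)"
    and complete:
      "(\<And>n. s n \<in> H) \<Longrightarrow>
       (\<And>e. 0 < e \<Longrightarrow> \<exists>N. \<forall>m\<ge>N. \<forall>n\<ge>N. hnorm ip (\<lambda>x. s m x - s n x) < e) \<Longrightarrow>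
       \<exists>f\<in>H. (\<lambda>n. hnorm ip (\<lambda>x. s n x - f x)) \<longlonglongrightarrow> 0"
    and kernel_mem: "(\<lambda>x. k x y) \<in> H"
    and reproducing: "f \<in> H \<Longrightarrow> ip f (\<lambda>x. k x y) = f y"
    and kernel_diag: "k x x \<noteq> 0"

definition normalized_at :: "('x \<Rightarrow> 'x \<Rightarrow> complex) \<Rightarrow> 'x \<Rightarrow> bool" where
  "normalized_at k x0 \<longleftrightarrow> (\<forall>x. k x x0 = 1)"

definition Mult :: "('x \<Rightarrow> complex) set \<Rightarrow> ('x \<Rightarrow> complex) set" where
  "Mult H = {\<phi>. \<forall>f\<in>H. (\<lambda>x. \<phi> x * f x) \<in> H}"

text \<open>
  Operator norms are suprema in \<open>[0, \<infinity>]\<close>, since a supremum of reals is unspecified for unbounded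
  sets. Multiplication operators on an RKHS are bounded, so the value is always finite there.
\<close>

definition mult_norm ::
  "('x \<Rightarrow> complex) set \<Rightarrow> (('x \<Rightarrow> complex) \<Rightarrow> ('x \<Rightarrow> complex) \<Rightarrow> complex) \<Rightarrow> ('x \<Rightarrow> complex) \<Rightarrow> ennreal"
where
  "mult_norm H ip \<phi> = (SUP f\<in>{f \<in> H. hnorm ip f \<le> 1}. ennreal (hnorm ip (\<lambda>x. \<phi> x * f x)))"

text \<open>
  \<open>\<H> \<otimes> \<complex>\<^sup>r\<close> is realized as the \<open>r\<close>-tuples of elements of \<open>H\<close>, with the Hilbert direct sum norm.
\<close>

definition tuple_norm ::
  "(('x \<Rightarrow> complex) \<Rightarrow> ('x \<Rightarrow> complex) \<Rightarrow> complex) \<Rightarrow> ('x \<Rightarrow> complex) vec \<Rightarrow> real"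
where
  "tuple_norm ip F = sqrt (\<Sum>i<dim_vec F. (hnorm ip (F $ i))\<^sup>2)"

definition mat_mult_op ::
  "('x \<Rightarrow> complex) mat \<Rightarrow> ('x \<Rightarrow> complex) vec \<Rightarrow> ('x \<Rightarrow> complex) vec"
where
  "mat_mult_op \<Phi> F = vec (dim_row \<Phi>) (\<lambda>i x. \<Sum>j<dim_col \<Phi>. (\<Phi> $$ (i, j)) x * (F $ j) x)"

definition mat_mult_norm ::
  "('x \<Rightarrow> complex) set \<Rightarrow> (('x \<Rightarrow> complex) \<Rightarrow> ('x \<Rightarrow> complex) \<Rightarrow> complex) \<Rightarrow>
   ('x \<Rightarrow> complex) mat \<Rightarrow> ennreal"
where
  "mat_mult_norm H ip \<Phi> =
     (SUP F\<in>{F \<in> carrier_vec (dim_col \<Phi>). (\<forall>j<dim_col \<Phi>. F $ j \<in> H) \<and> tuple_norm ip F \<le> 1}.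
        ennreal (tuple_norm ip (mat_mult_op \<Phi> F)))"

definition psd_mat :: "complex mat \<Rightarrow> bool" where
  "psd_mat A \<longleftrightarrow> square_mat A \<and> (\<forall>v \<in> carrier_vec (dim_row A). 0 \<le> (A *\<^sub>v v) \<bullet>c v)"

text \<open>
  The Pick matrix is flattened: entry \<open>(a, b)\<close> of its \<open>r \<times> r\<close> block \<open>(i, j)\<close> sits in position
  \<open>(i * r + a, j * r + b)\<close>.
\<close>

definition pick_mat ::
  "('x \<Rightarrow> 'x \<Rightarrow> complex) \<Rightarrow> nat \<Rightarrow> nat \<Rightarrow> (nat \<Rightarrow> 'x) \<Rightarrow> (nat \<Rightarrow> complex mat) \<Rightarrow> complex mat"
where
  "pick_mat k r n z W = mat (n * r) (n * r)
     (\<lambda>(p, q). (k (z (p div r)) (z (q div r)) \<cdot>\<^sub>m (1\<^sub>m r - W (p div r) * mat_adjoint (W (q div r))))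
                 $$ (p mod r, q mod r))"

definition complete_pick ::
  "('x \<Rightarrow> complex) set \<Rightarrow> (('x \<Rightarrow> complex) \<Rightarrow> ('x \<Rightarrow> complex) \<Rightarrow> complex) \<Rightarrow>
   ('x \<Rightarrow> 'x \<Rightarrow> complex) \<Rightarrow> bool"
where
  "complete_pick H ip k \<longleftrightarrow>
     (\<forall>r n z W. (\<forall>i<n. W i \<in> carrier_mat r r) \<and> psd_mat (pick_mat k r n z W) \<longrightarrow>
        (\<exists>\<Phi> \<in> carrier_mat r r. elements_mat \<Phi> \<subseteq> Mult H \<and> mat_mult_norm H ip \<Phi> \<le> 1 \<and>
           (\<forall>i<n. map_mat (\<lambda>\<phi>. \<phi> (z i)) \<Phi> = W i)))"

definition cyclic_mult ::
  "('x \<Rightarrow> complex) set \<Rightarrow> (('x \<Rightarrow> complex) \<Rightarrow> ('x \<Rightarrow> complex) \<Rightarrow> complex) \<Rightarrow> ('x \<Rightarrow> complex) \<Rightarrow> bool"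
where
  "cyclic_mult H ip \<psi> \<longleftrightarrow>
     \<psi> \<in> Mult H \<and> (\<forall>g\<in>H. \<forall>e>0. \<exists>f\<in>H. hnorm ip (\<lambda>x. g x - \<psi> x * f x) < e)"

text \<open>
  Cyclic multipliers vanish nowhere (\<open>kernel_diag\<close>), so the quotient never divides by zero.
\<close>

definition smirnov ::
  "('x \<Rightarrow> complex) set \<Rightarrow> (('x \<Rightarrow> complex) \<Rightarrow> ('x \<Rightarrow> complex) \<Rightarrow> complex) \<Rightarrow> ('x \<Rightarrow> complex) set"
where
  "smirnov H ip = {(\<lambda>x. \<phi> x / \<psi> x) |\<phi> \<psi>. \<phi> \<in> Mult H \<and> cyclic_mult H ip \<psi>}"

end

theory Submission
  imports Defs
begin

text \<open>
  The proof has two halves. The first extracts from the complete Pick property the kernel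
  inequality \<open>1 - 1/k \<ge> 0\<close>; the second deduces the theorem from this inequality, with explicit
  \<open>\<phi>\<close> and \<open>\<psi>\<close>.

  Let \<open>\<parallel>f\<parallel> = 1\<close>; the general case follows by scaling \<open>\<phi>\<close>. Put \<open>h(z) = \<langle>f, k\<^sub>z f\<rangle>\<close>, where \<open>k\<^sub>z = k(\<cdot>, z)\<close>, and
  \<open>\<phi> = f/h\<close>, \<open>\<psi> = 1 - 1/h\<close>. In the Hardy space \<open>2h - 1\<close> is the Herglotz transform of
  \<open>|f|\<^sup>2\<close>, the Sarason function of \<open>f\<close>. Then \<open>f = \<phi>/(1 - \<psi>)\<close> holds by construction, and
  \<open>\<psi>(x\<^sub>0) = 0\<close> because \<open>h(x\<^sub>0) = \<langle>f, f\<rangle> = 1\<close>. It remains to see that \<open>k (1 - \<phi> \<phi>\<^sup>*)\<close> and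
  \<open>k (1 - \<psi> \<psi>\<^sup>*)\<close> are positive semidefinite, which makes \<open>\<phi>\<close> and \<open>\<psi>\<close> contractive multipliers
  (\<open>mult_criterion_contractive\<close>).

  Both follow from one inequality. Put \<open>B = 1 - 1/k\<close>. If \<open>B\<close> is factored as \<open>B(x, y) = \<langle>b(x), b(y)\<rangle>\<close>,
  then \<open>1 + B k = k\<close> says that the constant function \<open>1\<close> together with multiplication by the
  components of \<open>b\<close> is a row contraction from \<open>\<complex> \<oplus> \<H> \<oplus> \<H> \<oplus> \<dots>\<close> to \<open>\<H>\<close>
  (\<open>row_contraction\<close>, stated without choosing \<open>b\<close>). Hence, if functions \<open>p\<^sub>j\<close>, \<open>Y\<^sub>j\<close> in \<open>\<H>\<close> satisfy
  \<open>Y\<^sub>j = \<alpha>\<^sub>j + B(\<cdot>, j) p\<^sub>j\<close>, the contraction inequality for their Gram matrices, multiplied entrywise by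
  \<open>k\<close>, gives \<open>k(i, j) (\<alpha>\<^sub>i\<^sup>* \<alpha>\<^sub>j + \<langle>p\<^sub>j, p\<^sub>i\<rangle> - \<langle>Y\<^sub>j, Y\<^sub>i\<rangle>) \<ge> 0\<close> (\<open>transfer_kernel_psd\<close>). Two choices of
  these functions give the two positivity statements (\<open>sarason_function_bounds\<close>); they are the state
  equations of the transfer function realizations of \<open>\<psi>\<close> and \<open>\<phi>\<close>.

  The inequality \<open>1 - 1/k \<ge> 0\<close> is the necessity half of the McCullough--Quiggin theorem, proved here by
  induction on the number of points for the kernels normalized at an arbitrary base point. The
  key is \<open>pick_compression\<close>: a solution of a Pick problem also multiplies the subspace of functions vanishing
  at \<open>u\<close>, so a positive Pick matrix stays positive when \<open>k\<close> is replaced by the kernel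
  \<open>k - k(\<cdot>, u) k(u, \<cdot>)/k(u, u)\<close> of that subspace. The induction hypothesis at one of the points provides
  row vectors \<open>w\<^sub>i\<close> for which the Pick matrix \<open>k(i, j) (1 - w\<^sub>i w\<^sub>j\<^sup>*)\<close> has rank one; compressing it
  yields the claim.

  Finally \<open>1 - \<psi>\<close> is cyclic for every contractive multiplier \<open>\<psi>\<close> for which it has no zeros, since a
  vector \<open>d\<close> orthogonal to \<open>(1 - \<psi>)\<H>\<close> satisfies \<open>\<langle>\<psi> d, d\<rangle> = \<parallel>d\<parallel>\<^sup>2\<close> and therefore \<open>\<psi> d = d\<close>.
\<close>

section \<open>Positive semidefinite kernels\<close>

definition qform :: "'i set \<Rightarrow> ('i \<Rightarrow> 'i \<Rightarrow> complex) \<Rightarrow> ('i \<Rightarrow> complex) \<Rightarrow> complex" where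
  "qform A M c = (\<Sum>i\<in>A. \<Sum>j\<in>A. cnj (c i) * M i j * c j)"

definition psd_on :: "'i set \<Rightarrow> ('i \<Rightarrow> 'i \<Rightarrow> complex) \<Rightarrow> bool" where
  "psd_on A M \<longleftrightarrow> (\<forall>i\<in>A. \<forall>j\<in>A. M j i = cnj (M i j)) \<and> (\<forall>c. 0 \<le> Re (qform A M c))"

lemma psd_onI:
  assumes "\<And>i j. i \<in> A \<Longrightarrow> j \<in> A \<Longrightarrow> M j i = cnj (M i j)"
    and "\<And>c. 0 \<le> Re (qform A M c)"
  shows "psd_on A M"
  using assms unfolding psd_on_def by blast

lemma psd_on_herm: "psd_on A M \<Longrightarrow> i \<in> A \<Longrightarrow> j \<in> A \<Longrightarrow> M j i = cnj (M i j)"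
  unfolding psd_on_def by blast

lemma psd_on_nonneg: "psd_on A M \<Longrightarrow> 0 \<le> Re (qform A M c)"
  unfolding psd_on_def by blast

lemma qform_cong:
  assumes "\<And>i j. i \<in> A \<Longrightarrow> j \<in> A \<Longrightarrow> M i j = N i j"
  shows "qform A M c = qform A N c"
  unfolding qform_def using assms by (intro sum.cong refl) auto

lemma psd_on_cong:
  assumes "psd_on A M" and eq: "\<And>i j. i \<in> A \<Longrightarrow> j \<in> A \<Longrightarrow> N i j = M i j"
  shows "psd_on A N"
proof (rule psd_onI)
  fix i j assume "i \<in> A" "j \<in> A"
  then show "N j i = cnj (N i j)" by (simp only: eq psd_on_herm[OF assms(1), of i j])
next
  fix c
  show "0 \<le> Re (qform A N c)"
    using psd_on_nonneg[OF assms(1), of c] qform_cong[of A N M c] eq by simp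
qed

lemma qform_supported:
  assumes "finite A" "S \<subseteq> A" "\<And>i. i \<in> A - S \<Longrightarrow> c i = 0"
  shows "qform A M c = qform S M c"
proof -
  have "(\<Sum>j\<in>A. cnj (c i) * M i j * c j) = (\<Sum>j\<in>S. cnj (c i) * M i j * c j)" for i
    by (rule sum.mono_neutral_right) (use assms in auto)
  moreover have "(\<Sum>i\<in>A. \<Sum>j\<in>S. cnj (c i) * M i j * c j) = (\<Sum>i\<in>S. \<Sum>j\<in>S. cnj (c i) * M i j * c j)"
    by (rule sum.mono_neutral_right) (use assms in auto)
  ultimately show ?thesis unfolding qform_def by simp
qed

lemma psd_on_subset:
  assumes "psd_on A M" "S \<subseteq> A" "finite A"
  shows "psd_on S M"
proof (rule psd_onI)
  fix i j assume "i \<in> S" "j \<in> S"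
  then have "i \<in> A" "j \<in> A" using assms(2) by auto
  then show "M j i = cnj (M i j)" by (rule psd_on_herm[OF assms(1)])
next
  fix c :: "_ \<Rightarrow> complex"
  let ?c = "\<lambda>i. if i \<in> S then c i else 0"
  have "qform A M ?c = qform S M ?c" by (rule qform_supported) (use assms in auto)
  also have "\<dots> = qform S M c" unfolding qform_def by (intro sum.cong refl) auto
  finally show "0 \<le> Re (qform S M c)" using psd_on_nonneg[OF assms(1), of ?c] by simp
qed

lemma psd_on_extend_zero:
  assumes S: "psd_on S M" and C: "finite C" "S \<subseteq> C"
    and zero: "\<And>i j. i \<in> C - S \<or> j \<in> C - S \<Longrightarrow> M i j = 0"
  shows "psd_on C M"
proof (rule psd_onI)
  fix i j assume "i \<in> C" "j \<in> C"
  then show "M j i = cnj (M i j)"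
    using zero psd_on_herm[OF S, of i j] by (cases "i \<in> S"; cases "j \<in> S") auto
next
  fix c
  have "qform C M c = qform C M (\<lambda>i. if i \<in> S then c i else 0)"
    unfolding qform_def by (intro sum.cong refl) (use zero in auto)
  also have "\<dots> = qform S M (\<lambda>i. if i \<in> S then c i else 0)"
    by (rule qform_supported) (use C in auto)
  finally show "0 \<le> Re (qform C M c)" using psd_on_nonneg[OF S] by simp
qed

lemma psd_on_add:
  assumes "psd_on A M" "psd_on A N"
  shows "psd_on A (\<lambda>i j. M i j + N i j)"
proof (rule psd_onI)
  fix i j assume "i \<in> A" "j \<in> A"
  then show "M j i + N j i = cnj (M i j + N i j)"
    using psd_on_herm[OF assms(1), of i j] psd_on_herm[OF assms(2), of i j] by simp
next
  fix c
  have "qform A (\<lambda>i j. M i j + N i j) c = qform A M c + qform A N c"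
    unfolding qform_def by (simp add: algebra_simps sum.distrib)
  then show "0 \<le> Re (qform A (\<lambda>i j. M i j + N i j) c)"
    using psd_on_nonneg[OF assms(1), of c] psd_on_nonneg[OF assms(2), of c] by simp
qed

lemma psd_on_congruence:
  assumes "psd_on A M"
  shows "psd_on A (\<lambda>i j. f i * M i j * cnj (f j))"
proof (rule psd_onI)
  fix i j assume "i \<in> A" "j \<in> A"
  then show "f j * M j i * cnj (f i) = cnj (f i * M i j * cnj (f j))"
    using psd_on_herm[OF assms, of i j] by simp
next
  fix c
  have "qform A (\<lambda>i j. f i * M i j * cnj (f j)) c = qform A M (\<lambda>i. cnj (f i) * c i)"
    unfolding qform_def by (simp add: algebra_simps)
  then show "0 \<le> Re (qform A (\<lambda>i j. f i * M i j * cnj (f j)) c)"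
    using psd_on_nonneg[OF assms] by simp
qed

lemma psd_on_rank_one: "psd_on A (\<lambda>i j. f i * cnj (f j))"
proof (rule psd_onI)
  fix c
  have "qform A (\<lambda>i j. f i * cnj (f j)) c = (\<Sum>i\<in>A. cnj (c i) * f i) * cnj (\<Sum>i\<in>A. cnj (c i) * f i)"
    unfolding qform_def cnj_sum sum_product by (intro sum.cong refl) simp
  then show "0 \<le> Re (qform A (\<lambda>i j. f i * cnj (f j)) c)"
    by (simp only: complex_norm_square[symmetric] Re_complex_of_real zero_le_power2)
qed simp

lemma psd_on_scale:
  assumes "psd_on A M" "0 \<le> r"
  shows "psd_on A (\<lambda>i j. complex_of_real r * M i j)"
proof -
  have "of_real (sqrt r) * of_real (sqrt r) = (of_real r :: complex)"
    using assms(2) by (metis of_real_mult real_sqrt_mult_self abs_of_nonneg)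
  then have "complex_of_real (sqrt r) * z * cnj (of_real (sqrt r)) = of_real r * z" for z
    by (metis complex_cnj_complex_of_real mult.assoc mult.commute)
  then show ?thesis
    using psd_on_congruence[OF assms(1), of "\<lambda>_. of_real (sqrt r)"] by (simp only:)
qed

lemma psd_on_diag:
  assumes "psd_on A M" "finite A" "i \<in> A"
  shows "0 \<le> Re (M i i)" "M i i = of_real (Re (M i i))"
proof -
  have "psd_on {i} M" using psd_on_subset[OF assms(1)] assms by blast
  from psd_on_nonneg[OF this, of "\<lambda>_. 1"] show "0 \<le> Re (M i i)" by (simp add: qform_def)
  from psd_on_herm[OF assms(1,3,3)] show "M i i = of_real (Re (M i i))"
    by (simp add: complex_eq_iff)
qed

lemma psd_on_image:
  assumes "bij_betw e B A" "psd_on B (\<lambda>i j. M (e i) (e j))"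
  shows "psd_on A M"
proof (rule psd_onI)
  fix i j assume "i \<in> A" "j \<in> A"
  then obtain a b where "a \<in> B" "b \<in> B" "i = e a" "j = e b"
    using assms(1) by (auto simp: bij_betw_def)
  then show "M j i = cnj (M i j)" using psd_on_herm[OF assms(2), of a b] by simp
next
  fix c
  have "qform A M c = qform B (\<lambda>i j. M (e i) (e j)) (\<lambda>i. c (e i))"
    unfolding qform_def
    by (simp add: sum.reindex_bij_betw[OF assms(1), symmetric])
  then show "0 \<le> Re (qform A M c)" using psd_on_nonneg[OF assms(2)] by simp
qed

text \<open>
  Completing the square in the variable of index \<open>z\<close>. When \<open>M z z = 0\<close> the quotient is \<open>0\<close> by
  convention, and no correction is due: by the second part the whole column vanishes then.
\<close>

lemma psd_on_schur_complement:
  assumes psd: "psd_on A M" and fin: "finite A" and z: "z \<in> A"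
  shows "psd_on A (\<lambda>i j. M i j - M i z * M z j / M z z)"
    and "M z z = 0 \<Longrightarrow> i \<in> A \<Longrightarrow> M i z = 0"
proof -
  have her: "M j i = cnj (M i j)" if "i \<in> A" "j \<in> A" for i j using psd_on_herm[OF psd that] .
  define s where "s c = (\<Sum>j\<in>A. M z j * c j)" for c
  have cnjs: "cnj (s c) = (\<Sum>i\<in>A. cnj (c i) * M i z)" for c
    unfolding s_def cnj_sum using her[OF z] by (intro sum.cong refl) simp
  have shift: "qform A M (\<lambda>i. c i + (if i = z then t else 0))
      = qform A M c + t * cnj (s c) + cnj t * s c + cnj t * t * M z z" for c t
  proof -
    let ?d = "\<lambda>i. if i = z then t else 0"
    have "qform A M (\<lambda>i. c i + ?d i)
      = (\<Sum>i\<in>A. \<Sum>j\<in>A. cnj (c i) * M i j * c j) + (\<Sum>i\<in>A. \<Sum>j\<in>A. cnj (c i) * M i j * ?d j)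
        + (\<Sum>i\<in>A. \<Sum>j\<in>A. cnj (?d i) * M i j * c j) + (\<Sum>i\<in>A. \<Sum>j\<in>A. cnj (?d i) * M i j * ?d j)"
      unfolding qform_def sum.distrib[symmetric]
      by (intro sum.cong refl) (simp add: algebra_simps)
    moreover have "(\<Sum>i\<in>A. \<Sum>j\<in>A. cnj (c i) * M i j * ?d j) = t * cnj (s c)"
    proof -
      have "(\<Sum>j\<in>A. cnj (c i) * M i j * ?d j) = cnj (c i) * M i z * t" for i
        using fin z by (simp add: if_distrib[of "\<lambda>x. _ * x"] sum.delta cong: if_cong)
      then show ?thesis by (simp add: cnjs sum_distrib_left mult_ac)
    qed
    moreover have "(\<Sum>i\<in>A. \<Sum>j\<in>A. cnj (?d i) * M i j * c j) = cnj t * s c"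
    proof -
      have "(\<Sum>j\<in>A. cnj (?d i) * M i j * c j) = (if i = z then cnj t * s c else 0)" for i
        by (simp add: s_def sum_distrib_left mult_ac)
      then show ?thesis using fin z by simp
    qed
    moreover have "(\<Sum>i\<in>A. \<Sum>j\<in>A. cnj (?d i) * M i j * ?d j) = cnj t * t * M z z"
    proof -
      have "(\<Sum>j\<in>A. cnj (?d i) * M i j * ?d j) = (if i = z then cnj t * M z z * t else 0)" for i
        using fin z by (simp add: if_distrib[of "\<lambda>x. _ * x"] sum.delta cong: if_cong)
      then show ?thesis using fin z by simp
    qed
    ultimately show ?thesis unfolding qform_def by simp
  qed
  have s0: "s c = 0" if "M z z = 0" for c
  proof (rule ccontr)
    assume ne: "s c \<noteq> 0"
    \<comment> \<open>The form is affine along \<open>t\<close>; this \<open>t\<close> is long enough to make it negative.\<close>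
    define t where "t = - (of_real ((Re (qform A M c) + 1) / (cmod (s c))\<^sup>2)) * s c"
    have ss: "s c * cnj (s c) = of_real ((cmod (s c))\<^sup>2)"
      by (rule complex_norm_square[symmetric])
    have pos: "(cmod (s c))\<^sup>2 \<noteq> 0" using ne by simp
    have "t * cnj (s c) = - (of_real ((Re (qform A M c) + 1) / (cmod (s c))\<^sup>2)) * (s c * cnj (s c))"
      unfolding t_def by simp
    also have "\<dots> = of_real (- (Re (qform A M c) + 1))"
      unfolding ss of_real_mult[symmetric] of_real_minus[symmetric] using pos by simp
    finally have 1: "t * cnj (s c) = of_real (- (Re (qform A M c) + 1))" .
    then have "cnj t * s c = cnj (of_real (- (Re (qform A M c) + 1)))"
      by (metis complex_cnj_mult complex_cnj_cnj)
    then have 2: "cnj t * s c = of_real (- (Re (qform A M c) + 1))" by (simp only: complex_cnj_complex_of_real)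
    have "0 \<le> Re (qform A M (\<lambda>i. c i + (if i = z then t else 0)))"
      using psd_on_nonneg[OF psd] .
    then have "0 \<le> Re (qform A M c) + (- (Re (qform A M c) + 1)) + (- (Re (qform A M c) + 1))"
      unfolding shift 1 2 that by simp
    moreover have "0 \<le> Re (qform A M c)" using psd_on_nonneg[OF psd] .
    ultimately show False by simp
  qed
  show zero: "M i z = 0" if "M z z = 0" "i \<in> A" for i
  proof -
    have "s (\<lambda>j. if j = i then 1 else 0) = M z i"
      unfolding s_def using fin that by (simp add: if_distrib[of "\<lambda>x. _ * x"] sum.delta cong: if_cong)
    then show ?thesis using s0[OF that(1)] her[of z i] that z by simp
  qed
  show "psd_on A (\<lambda>i j. M i j - M i z * M z j / M z z)"
  proof (rule psd_onI)
    fix i j assume "i \<in> A" "j \<in> A"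
    then show "M j i - M j z * M z i / M z z = cnj (M i j - M i z * M z j / M z z)"
      using her[of i j] her[of z i] her[of j z] her[of z z] z by (simp add: mult_ac)
  next
    fix c
    have q: "qform A (\<lambda>i j. M i j - M i z * M z j / M z z) c
        = qform A M c - s c * cnj (s c) / M z z"
    proof -
      have "s c * cnj (s c) / M z z = cnj (s c) * s c / M z z" by simp
      also have "\<dots> = (\<Sum>i\<in>A. \<Sum>j\<in>A. (cnj (c i) * M i z) * (M z j * c j)) / M z z"
        unfolding cnjs unfolding s_def sum_product ..
      also have "\<dots> = (\<Sum>i\<in>A. \<Sum>j\<in>A. cnj (c i) * (M i z * M z j / M z z) * c j)"
        unfolding sum_divide_distrib by (intro sum.cong refl) simp
      finally have 1: "s c * cnj (s c) / M z z = (\<Sum>i\<in>A. \<Sum>j\<in>A. cnj (c i) * (M i z * M z j / M z z) * c j)" .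
      show ?thesis
        unfolding qform_def 1 sum_subtractf[symmetric]
        by (intro sum.cong refl) (simp only: right_diff_distrib left_diff_distrib)
    qed
    show "0 \<le> Re (qform A (\<lambda>i j. M i j - M i z * M z j / M z z) c)"
    proof (cases "M z z = 0")
      case True
      then show ?thesis unfolding q using psd_on_nonneg[OF psd] by simp
    next
      case False
      \<comment> \<open>The minimizer of the form along the coordinate \<open>z\<close>.\<close>
      define t where "t = - s c / M z z"
      have ct: "cnj t = - cnj (s c) / M z z"
        unfolding t_def using her[OF z z] by simp
      have 1: "qform A M c + t * cnj (s c) + cnj t * s c + cnj t * t * M z z
          = qform A M c - s c * cnj (s c) / M z z"
        unfolding ct t_def using False by (simp add: field_simps)
      have "0 \<le> Re (qform A M (\<lambda>i. c i + (if i = z then t else 0)))"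
        by (rule psd_on_nonneg[OF psd])
      then show ?thesis unfolding q shift 1 .
    qed
  qed
qed

text \<open>
  The Cholesky decomposition, by induction on the index set: split off the column of the new index
  \<open>z\<close>, and factor the Schur complement, whose row and column at \<open>z\<close> are zero.
\<close>

lemma psd_on_factorization:
  assumes "finite A" "psd_on A M"
  shows "\<exists>m w. \<forall>i\<in>A. \<forall>j\<in>A. M i j = (\<Sum>a<(m::nat). w i a * cnj (w j a))"
  using assms
proof (induction A arbitrary: M rule: finite_induct)
  case empty
  then show ?case by simp
next
  case (insert z A)
  let ?A = "insert z A"
  have fin: "finite ?A" and z: "z \<in> ?A" using insert by auto
  note schur = psd_on_schur_complement[OF insert.prems fin z]
  define N where "N = (\<lambda>i j. M i j - M i z * M z j / M z z)"
  have "psd_on A N"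
    using psd_on_subset[OF schur(1)] fin unfolding N_def by blast
  then obtain m w where w: "\<And>i j. i \<in> A \<Longrightarrow> j \<in> A \<Longrightarrow> N i j = (\<Sum>a<(m::nat). w i a * cnj (w j a))"
    using insert.IH by blast
  define d where "d = sqrt (Re (M z z))"
  have dd: "of_real d * of_real d = M z z"
    using psd_on_diag[OF insert.prems fin z] unfolding d_def
    by (metis of_real_mult real_sqrt_mult_self abs_of_nonneg)
  define w' where "w' = (\<lambda>i a. if a = m then M i z / of_real d else if i = z then 0 else w i a)"
  have her: "M j i = cnj (M i j)" if "i \<in> ?A" "j \<in> ?A" for i j
    using psd_on_herm[OF insert.prems that] .
  have "M i j = (\<Sum>a<Suc m. w' i a * cnj (w' j a))" if ij: "i \<in> ?A" "j \<in> ?A" for i j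
  proof -
    have last: "w' i m * cnj (w' j m) = M i z * M z j / M z z"
      unfolding w'_def using her[OF ij(2) z] dd[symmetric] by simp
    have rest: "(\<Sum>a<m. w' i a * cnj (w' j a)) = N i j"
    proof (cases "i = z \<or> j = z")
      case True
      then have "(\<Sum>a<m. w' i a * cnj (w' j a)) = 0"
        by (intro sum.neutral) (auto simp: w'_def)
      moreover have "M i z * M z j / M z z = M i j"
      proof (cases "M z z = 0")
        case z0: True
        have "M i z = 0" "M j z = 0" using schur(2)[OF z0] ij by auto
        then show ?thesis using True her[OF ij(2) z] by auto
      qed (use True in auto)
      ultimately show ?thesis by (simp add: N_def)
    next
      case False
      then show ?thesis using w ij by (auto simp: w'_def)
    qed
    show ?thesis by (simp add: last rest N_def)
  qed
  then show ?case by blast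
qed

text \<open>
  A factorization of \<open>M\<close> writes the entrywise product as a sum of diagonal congruences of \<open>N\<close>.
\<close>

lemma psd_on_schur_product:
  assumes fin: "finite A" and M: "psd_on A M" and N: "psd_on A N"
  shows "psd_on A (\<lambda>i j. M i j * N i j)"
proof -
  obtain m w where w: "\<And>i j. i \<in> A \<Longrightarrow> j \<in> A \<Longrightarrow> M i j = (\<Sum>a<(m::nat). w i a * cnj (w j a))"
    using psd_on_factorization[OF fin M] by blast
  have "psd_on A (\<lambda>i j. (\<Sum>a<n. w i a * N i j * cnj (w j a)))" for n :: nat
  proof (induction n)
    case 0
    show ?case by (rule psd_onI) (simp_all add: qform_def)
  next
    case (Suc n)
    show ?case using psd_on_add[OF Suc psd_on_congruence[OF N, of "\<lambda>i. w i n"]] by simp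
  qed
  from psd_on_cong[OF this[of m], of "\<lambda>i j. M i j * N i j"] show ?thesis
    by (simp add: w sum_distrib_right sum_distrib_left mult_ac)
qed

section \<open>Hilbert function spaces and their contractive multipliers\<close>

context rkhs
begin

definition nsq :: "('x \<Rightarrow> complex) \<Rightarrow> real" where
  "nsq f = Re (ip f f)"

lemma nsq_ge_0: "f \<in> H \<Longrightarrow> 0 \<le> nsq f"
  using ip_nonneg[of f] by (simp add: nsq_def less_eq_complex_def)

lemma ip_self: "f \<in> H \<Longrightarrow> ip f f = of_real (nsq f)"
  using ip_nonneg[of f] by (simp add: nsq_def less_eq_complex_def complex_eq_iff)

lemma nsq_eq_0: "f \<in> H \<Longrightarrow> nsq f = 0 \<Longrightarrow> f = (\<lambda>x. 0)"
  using ip_self[of f] ip_definite[of f] by simp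

lemma hnorm_sq: "f \<in> H \<Longrightarrow> (hnorm ip f)\<^sup>2 = nsq f"
  using nsq_ge_0[of f] by (simp add: hnorm_def nsq_def)

lemma hnorm_ge_0: "f \<in> H \<Longrightarrow> 0 \<le> hnorm ip f"
  using nsq_ge_0[of f] by (simp add: hnorm_def nsq_def)

lemma diff_mem: "f \<in> H \<Longrightarrow> g \<in> H \<Longrightarrow> (\<lambda>x. f x - g x) \<in> H"
  using add_mem[OF _ scale_mem[of g "-1"], of f] by simp

lemma sum_mem:
  assumes "\<And>i. i \<in> A \<Longrightarrow> u i \<in> H"
  shows "(\<lambda>x. \<Sum>i\<in>A. u i x) \<in> H"
proof (cases "finite A")
  case True
  then show ?thesis using assms
    by (induction A rule: finite_induct) (auto intro: zero_mem add_mem)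
qed (simp add: zero_mem)

lemma lin_comb_mem:
  assumes "\<And>i. i \<in> A \<Longrightarrow> u i \<in> H"
  shows "(\<lambda>x. \<Sum>i\<in>A. c i * u i x) \<in> H"
  by (rule sum_mem) (simp add: assms scale_mem)

lemma ip_zero_left: "h \<in> H \<Longrightarrow> ip (\<lambda>x. 0) h = 0"
  using ip_scale[OF zero_mem, of h 0] by simp

lemma ip_sum_left:
  assumes "\<And>i. i \<in> A \<Longrightarrow> u i \<in> H" "h \<in> H"
  shows "ip (\<lambda>x. \<Sum>i\<in>A. u i x) h = (\<Sum>i\<in>A. ip (u i) h)"
proof (cases "finite A")
  case True
  then show ?thesis using assms
    by (induction A rule: finite_induct) (auto simp: ip_zero_left ip_add sum_mem)
qed (simp add: ip_zero_left assms)

lemma ip_lin_left: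
  assumes "\<And>i. i \<in> A \<Longrightarrow> u i \<in> H" "h \<in> H"
  shows "ip (\<lambda>x. \<Sum>i\<in>A. c i * u i x) h = (\<Sum>i\<in>A. c i * ip (u i) h)"
  using assms by (subst ip_sum_left) (auto simp: scale_mem ip_scale)

lemma ip_lin_right:
  assumes "\<And>i. i \<in> A \<Longrightarrow> u i \<in> H" "h \<in> H"
  shows "ip h (\<lambda>x. \<Sum>i\<in>A. c i * u i x) = (\<Sum>i\<in>A. cnj (c i) * ip h (u i))"
proof -
  have "ip h (\<lambda>x. \<Sum>i\<in>A. c i * u i x) = cnj (ip (\<lambda>x. \<Sum>i\<in>A. c i * u i x) h)"
    using assms by (intro ip_cnj lin_comb_mem) auto
  also have "\<dots> = (\<Sum>i\<in>A. cnj (c i) * ip h (u i))"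
    using assms ip_cnj[OF _ assms(2)] by (simp add: ip_lin_left)
  finally show ?thesis .
qed

lemma ip_scale_right: "f \<in> H \<Longrightarrow> h \<in> H \<Longrightarrow> ip h (\<lambda>x. c * f x) = cnj c * ip h f"
  using ip_cnj[OF scale_mem[of f c], of h] ip_scale[of f h c] ip_cnj[of f h] by simp

lemma ip_add_right: "f \<in> H \<Longrightarrow> g \<in> H \<Longrightarrow> h \<in> H \<Longrightarrow> ip h (\<lambda>x. f x + g x) = ip h f + ip h g"
  using ip_cnj[OF add_mem[of f g], of h] ip_add[of f g h] ip_cnj[of f h] ip_cnj[of g h] by simp

lemma ip_diff: "f \<in> H \<Longrightarrow> g \<in> H \<Longrightarrow> h \<in> H \<Longrightarrow> ip (\<lambda>x. f x - g x) h = ip f h - ip g h"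
  using ip_add[OF _ scale_mem[of g "-1"], of f h] ip_scale[of g h "-1"] by simp

lemma ip_diff_right: "f \<in> H \<Longrightarrow> g \<in> H \<Longrightarrow> h \<in> H \<Longrightarrow> ip h (\<lambda>x. f x - g x) = ip h f - ip h g"
  using ip_add_right[OF _ scale_mem[of g "-1"], of f h] ip_scale_right[of g h "-1"] by simp

lemma nsq_scale: "f \<in> H \<Longrightarrow> nsq (\<lambda>x. c * f x) = (cmod c)\<^sup>2 * nsq f"
proof -
  assume f: "f \<in> H"
  have "ip (\<lambda>x. c * f x) (\<lambda>x. c * f x) = (c * cnj c) * ip f f"
    using f by (simp add: ip_scale ip_scale_right scale_mem)
  then show ?thesis
    unfolding complex_norm_square[symmetric] nsq_def by simp
qed

lemma nsq_add: "f \<in> H \<Longrightarrow> g \<in> H \<Longrightarrow> nsq (\<lambda>x. f x + g x) = nsq f + nsq g + 2 * Re (ip f g)"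
  using ip_cnj[of f g] by (simp add: nsq_def ip_add ip_add_right add_mem)

lemma nsq_diff: "f \<in> H \<Longrightarrow> g \<in> H \<Longrightarrow> nsq (\<lambda>x. f x - g x) = nsq f + nsq g - 2 * Re (ip f g)"
  using ip_cnj[of f g] by (simp add: nsq_def ip_diff ip_diff_right diff_mem)

lemma two_Re_ip_le: "f \<in> H \<Longrightarrow> g \<in> H \<Longrightarrow> 2 * Re (ip f g) \<le> nsq f + nsq g"
  using nsq_ge_0[OF diff_mem[of f g]] nsq_diff[of f g] by simp

lemma hnorm_scale: "f \<in> H \<Longrightarrow> hnorm ip (\<lambda>x. c * f x) = cmod c * hnorm ip f"
  using nsq_scale[of f c] by (simp add: hnorm_def nsq_def real_sqrt_mult)

lemma cauchy_schwarz:
  assumes f: "f \<in> H" and g: "g \<in> H"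
  shows "cmod (ip f g) \<le> hnorm ip f * hnorm ip g"
proof (cases "nsq g = 0")
  case True
  then have "g = (\<lambda>x. 0)" using nsq_eq_0 g by blast
  then have "ip f g = 0" using ip_cnj[OF zero_mem f] ip_zero_left[OF f] by simp
  then show ?thesis using f g by (simp add: hnorm_ge_0)
next
  case False
  then have pos: "nsq g > 0" using nsq_ge_0[OF g] by simp
  define t where "t = ip f g / of_real (nsq g)"
  have cg: "(\<lambda>x. t * g x) \<in> H" using g scale_mem by blast
  have "0 \<le> nsq (\<lambda>x. f x - t * g x)" using f cg by (intro nsq_ge_0 diff_mem)
  also have "\<dots> = nsq f + (cmod t)\<^sup>2 * nsq g - 2 * Re (cnj t * ip f g)"
    using f g cg by (simp add: nsq_diff nsq_scale ip_scale_right)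
  also have "cnj t * ip f g = of_real ((cmod (ip f g))\<^sup>2 / nsq g)"
    unfolding t_def by (simp add: complex_norm_square[symmetric] mult.commute[of "cnj _"] flip: of_real_power)
  also have "(cmod t)\<^sup>2 * nsq g = (cmod (ip f g))\<^sup>2 / nsq g"
    unfolding t_def using pos by (simp add: norm_divide power_divide power2_eq_square)
  finally have "(cmod (ip f g))\<^sup>2 / nsq g \<le> nsq f" by simp
  then have "(cmod (ip f g))\<^sup>2 \<le> nsq f * nsq g" using pos by (simp add: field_simps)
  also have "\<dots> = (hnorm ip f * hnorm ip g)\<^sup>2"
    using f g by (simp add: power_mult_distrib hnorm_sq)
  finally show ?thesis
    by (rule power2_le_imp_le) (use f g hnorm_ge_0 in auto)
qed

lemma psd_on_gram:
  assumes "\<And>i. i \<in> A \<Longrightarrow> u i \<in> H"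
  shows "psd_on A (\<lambda>i j. ip (u j) (u i))"
    and "qform A (\<lambda>i j. ip (u j) (u i)) c = ip (\<lambda>x. \<Sum>i\<in>A. c i * u i x) (\<lambda>x. \<Sum>i\<in>A. c i * u i x)"
proof -
  show q: "qform A (\<lambda>i j. ip (u j) (u i)) c
      = ip (\<lambda>x. \<Sum>i\<in>A. c i * u i x) (\<lambda>x. \<Sum>i\<in>A. c i * u i x)" for c
    unfolding qform_def using assms
    by (simp add: ip_lin_right ip_lin_left lin_comb_mem sum_distrib_left mult_ac)
  show "psd_on A (\<lambda>i j. ip (u j) (u i))"
  proof (rule psd_onI)
    fix i j assume "i \<in> A" "j \<in> A"
    then show "ip (u i) (u j) = cnj (ip (u j) (u i))" using assms ip_cnj by blast
  next
    fix c
    show "0 \<le> Re (qform A (\<lambda>i j. ip (u j) (u i)) c)"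
      unfolding q using nsq_ge_0[OF lin_comb_mem[of A u c]] assms by (simp add: nsq_def)
  qed
qed

lemma kernel_herm: "k x y = cnj (k y x)"
  using ip_cnj[OF kernel_mem[of x] kernel_mem[of y]]
  by (simp add: reproducing kernel_mem)

lemma psd_on_kernel: "psd_on A k"
  and qform_kernel: "qform A k c = ip (\<lambda>x. \<Sum>i\<in>A. c i * k x i) (\<lambda>x. \<Sum>i\<in>A. c i * k x i)"
  using psd_on_gram[of A "\<lambda>y x. k x y"] by (simp_all add: kernel_mem reproducing)

lemma ip_kernel_comb:
  assumes "f \<in> H"
  shows "ip f (\<lambda>x. \<Sum>i\<in>A. c i * k x i) = (\<Sum>i\<in>A. cnj (c i) * f i)"
  using assms by (subst ip_lin_right) (simp_all add: kernel_mem reproducing)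

text \<open>
  The Riesz representation theorem for a linear functional given by its graph \<open>R\<close>, which avoids
  checking that a functional defined on linear combinations is well defined. As \<open>R\<close> is closed under
  scaling, the bound means that the functional has squared norm at most \<open>C\<close>. The representing vector is the
  limit of a minimizing sequence of \<open>\<parallel>g\<parallel>\<^sup>2 - 2 Re l\<close>, so it lies in the closure of the
  domain; the last conclusion, which records this, yields density statements.
\<close>

lemma bounded_graph_functional:
  assumes ne: "R \<noteq> {}"
    and RH: "\<And>g l. (g, l) \<in> R \<Longrightarrow> g \<in> H"
    and Radd: "\<And>g l g' l'. (g, l) \<in> R \<Longrightarrow> (g', l') \<in> R \<Longrightarrow> (\<lambda>x. g x + g' x, l + l') \<in> R"
    and Rscale: "\<And>g l c. (g, l) \<in> R \<Longrightarrow> (\<lambda>x. c * g x, c * l) \<in> R"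
    and bound: "\<And>g l. (g, l) \<in> R \<Longrightarrow> 2 * Re l \<le> C + nsq g"
  obtains w where "w \<in> H" "nsq w \<le> C"
    "\<And>g l. (g, l) \<in> R \<Longrightarrow> l = ip g w"
    "\<And>e. 0 < e \<Longrightarrow> \<exists>(g, l)\<in>R. hnorm ip (\<lambda>x. g x - w x) < e"
proof -
  define J where "J = (\<lambda>(g, l). nsq g - 2 * Re l)"
  define m where "m = Inf (J ` R)"
  have bdd: "bdd_below (J ` R)"
    by (rule bdd_belowI[of _ "-C"]) (use bound in \<open>force simp: J_def\<close>)
  have m_le: "m \<le> nsq g - 2 * Re l" if "(g, l) \<in> R" for g l
    unfolding m_def using cInf_lower[OF imageI[OF that, of J] bdd] by (simp add: J_def)
  have "\<exists>p\<in>R. J p < m + inverse (real (Suc n))" for n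
    using cInf_lessD[of "J ` R" "m + inverse (real (Suc n))"] ne by (auto simp: m_def)
  then obtain p where p: "\<And>n. p n \<in> R" "\<And>n. J (p n) < m + inverse (real (Suc n))"
    by metis
  define s t where "s n = fst (p n)" and "t n = snd (p n)" for n
  have st: "(s n, t n) \<in> R" for n using p(1)[of n] by (simp add: s_def t_def)
  have sH: "s n \<in> H" for n using RH st by blast
  have Jst: "nsq (s n) - 2 * Re (t n) < m + inverse (real (Suc n))" for n
    using p(2)[of n] by (simp add: s_def t_def J_def split_def)
  have dist: "nsq (\<lambda>x. s i x - s j x) \<le> 2 * (inverse (real (Suc i)) + inverse (real (Suc j)))" for i j
  proof -
    \<comment> \<open>The parallelogram law at the midpoint of two almost minimizers.\<close>
    have "(\<lambda>x. (1/2) * (s i x + s j x), (1/2) * (t i + t j)) \<in> R"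
      using Rscale[OF Radd[OF st st]] .
    from m_le[OF this] have "m \<le> (1/4) * nsq (\<lambda>x. s i x + s j x) - Re (t i + t j)"
      unfolding nsq_scale[OF add_mem[OF sH[of i] sH[of j]]]
      by (simp add: power2_eq_square add_divide_distrib)
    moreover have "nsq (\<lambda>x. s i x - s j x) = 2 * nsq (s i) + 2 * nsq (s j) - nsq (\<lambda>x. s i x + s j x)"
      using sH by (simp add: nsq_diff nsq_add)
    ultimately show ?thesis using Jst[of i] Jst[of j] by simp
  qed
  have "\<exists>N. \<forall>i\<ge>N. \<forall>j\<ge>N. hnorm ip (\<lambda>x. s i x - s j x) < e" if e: "0 < e" for e
  proof -
    obtain N where N: "inverse (real (Suc N)) < e\<^sup>2 / 4"
      using reals_Archimedean[of "e\<^sup>2 / 4"] e by auto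
    have "hnorm ip (\<lambda>x. s i x - s j x) < e" if "i \<ge> N" "j \<ge> N" for i j
    proof -
      have "inverse (real (Suc i)) \<le> inverse (real (Suc N))" "inverse (real (Suc j)) \<le> inverse (real (Suc N))"
        using that by (auto intro!: le_imp_inverse_le)
      then have "inverse (real (Suc i)) + inverse (real (Suc j)) \<le> 2 * inverse (real (Suc N))"
        by (rule add_mono[THEN order_trans]) (simp only: mult_2)
      moreover have "a \<le> 2 * c \<Longrightarrow> b \<le> 2 * a \<Longrightarrow> c < e\<^sup>2 / 4 \<Longrightarrow> b < e\<^sup>2" for a b c :: real
        by simp
      ultimately have "nsq (\<lambda>x. s i x - s j x) < e\<^sup>2" using dist[of i j] N by blast
      then have "(hnorm ip (\<lambda>x. s i x - s j x))\<^sup>2 < e\<^sup>2"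
        using hnorm_sq[OF diff_mem[OF sH sH]] by simp
      then show ?thesis by (rule power2_less_imp_less) (use e in simp)
    qed
    then show ?thesis by blast
  qed
  from complete[OF sH this] obtain w where w: "w \<in> H"
    and lim: "(\<lambda>n. hnorm ip (\<lambda>x. s n x - w x)) \<longlonglongrightarrow> 0" by blast
  have lim_ip: "(\<lambda>n. ip g (s n)) \<longlonglongrightarrow> ip g w" if g: "g \<in> H" for g
  proof (rule LIM_zero_cancel, rule tendsto_0_le[OF lim, of _ "hnorm ip g"])
    show "\<forall>\<^sub>F n in sequentially. norm (ip g (s n) - ip g w)
        \<le> norm (hnorm ip (\<lambda>x. s n x - w x)) * hnorm ip g"
      using cauchy_schwarz[OF g diff_mem[OF sH w]] g sH w
      by (simp add: ip_diff_right hnorm_ge_0 diff_mem mult.commute)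
  qed
  have repr: "l = ip g w" if gl: "(g, l) \<in> R" for g l
  proof -
    have g: "g \<in> H" using RH gl by blast
    define d where "d = ip g w - l"
    \<comment> \<open>First variation: moving from the minimizer in the direction \<open>g\<close> does not decrease the functional.\<close>
    have var: "0 \<le> (cmod c)\<^sup>2 * nsq g + 2 * Re (c * d)" for c
    proof -
      have low: "- inverse (real (Suc n)) \<le> (cmod c)\<^sup>2 * nsq g + 2 * Re (c * (ip g (s n) - l))" for n
      proof -
        have cg: "(\<lambda>x. c * g x) \<in> H" using g scale_mem by blast
        have "m \<le> nsq (\<lambda>x. c * g x + s n x) - 2 * Re (c * l + t n)"
          using m_le[OF Radd[OF Rscale[OF gl] st]] .
        also have "nsq (\<lambda>x. c * g x + s n x) = (cmod c)\<^sup>2 * nsq g + nsq (s n) + 2 * Re (c * ip g (s n))"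
          using g cg sH by (simp add: nsq_add nsq_scale ip_scale)
        finally show ?thesis using Jst[of n] by (simp add: algebra_simps)
      qed
      have "(\<lambda>n. - inverse (real (Suc n))) \<longlonglongrightarrow> - 0"
        by (intro tendsto_minus LIMSEQ_inverse_real_of_nat)
      moreover have "(\<lambda>n. (cmod c)\<^sup>2 * nsq g + 2 * Re (c * (ip g (s n) - l)))
          \<longlonglongrightarrow> (cmod c)\<^sup>2 * nsq g + 2 * Re (c * d)"
        unfolding d_def by (intro tendsto_intros lim_ip g)
      ultimately have "- 0 \<le> (cmod c)\<^sup>2 * nsq g + 2 * Re (c * d)"
        by (rule LIMSEQ_le) (use low in blast)
      then show ?thesis by simp
    qed
    have "d = 0"
    proof (rule ccontr)
      assume "d \<noteq> 0"
      define r where "r = inverse (nsq g + 1)"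
      have r: "0 < r" "r * nsq g < 1" using nsq_ge_0[OF g] by (auto simp: r_def field_simps)
      have "0 \<le> (cmod (- of_real r * cnj d))\<^sup>2 * nsq g + 2 * Re (- of_real r * cnj d * d)"
        by (rule var)
      also have "(cmod (- of_real r * cnj d))\<^sup>2 = r\<^sup>2 * (cmod d)\<^sup>2"
        using r by (simp add: norm_mult power_mult_distrib)
      also have "- of_real r * cnj d * d = of_real (- (r * (cmod d)\<^sup>2))"
        using complex_norm_square[of d] by (simp add: mult.commute flip: of_real_power)
      finally have "0 \<le> (r * (cmod d)\<^sup>2) * (r * nsq g - 2)"
        by (simp add: algebra_simps power2_eq_square)
      moreover have "r * (cmod d)\<^sup>2 > 0" using r \<open>d \<noteq> 0\<close> by simp
      ultimately show False using r(2) by (simp add: zero_le_mult_iff)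
    qed
    then show ?thesis by (simp add: d_def)
  qed
  have low: "nsq w \<le> C + (hnorm ip (\<lambda>x. s n x - w x))\<^sup>2" for n
  proof -
    have "(hnorm ip (\<lambda>x. s n x - w x))\<^sup>2 = nsq (s n) + nsq w - 2 * Re (t n)"
      using repr[OF st, of n] sH w by (simp add: hnorm_sq diff_mem nsq_diff)
    then show ?thesis using bound[OF st, of n] by simp
  qed
  have "(\<lambda>n. C + (hnorm ip (\<lambda>x. s n x - w x))\<^sup>2) \<longlonglongrightarrow> C + 0\<^sup>2"
    by (intro tendsto_intros lim)
  then have "nsq w \<le> C + 0\<^sup>2"
    by (rule LIMSEQ_le_const) (use low in blast)
  then have "nsq w \<le> C" by simp
  moreover have "\<exists>(g, l)\<in>R. hnorm ip (\<lambda>x. g x - w x) < e" if "0 < e" for e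
  proof -
    have "\<forall>\<^sub>F n in sequentially. hnorm ip (\<lambda>x. s n x - w x) < e"
      using order_tendstoD(2)[OF lim that] .
    then show ?thesis using st by (auto dest!: eventually_happens)
  qed
  ultimately show thesis using that w repr by blast
qed

text \<open>
  The functional \<open>k\<^sub>x \<mapsto> cnj (v x)\<close> on the span of the kernel functions is bounded by the
  hypothesis, and the vector of \<open>H\<close> that represents it is \<open>v\<close>. The quadratic form of the bound,
  in place of \<open>|\<dots>|\<^sup>2 \<le> C \<parallel>\<dots>\<parallel>\<^sup>2\<close>, spares the Cauchy--Schwarz inequality in every application.
\<close>

lemma mem_criterion:
  assumes bound: "\<And>A c. finite A \<Longrightarrow>
    2 * Re (\<Sum>x\<in>A. cnj (c x) * v x) \<le> C + Re (qform A k c)"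
  shows "v \<in> H" "nsq v \<le> C"
proof -
  define R where "R = {((\<lambda>x. \<Sum>i\<in>A. c i * k x i), (\<Sum>i\<in>A. c i * cnj (v i))) | A c. finite A}"
  have comb: "(\<lambda>x. \<Sum>i\<in>A. c i * k x i) \<in> H" for A c
    by (rule lin_comb_mem) (rule kernel_mem)
  have ext: "\<exists>c'. (\<forall>f. (\<Sum>i\<in>A. c i * f i) = (\<Sum>i\<in>E. c' i * f i))"
    if "finite E" "A \<subseteq> E" for A E and c :: "'x \<Rightarrow> complex"
  proof (intro exI allI)
    fix f :: "'x \<Rightarrow> complex"
    show "(\<Sum>i\<in>A. c i * f i) = (\<Sum>i\<in>E. (if i \<in> A then c i else 0) * f i)"
      by (rule sum.mono_neutral_cong_left) (use that in auto)
  qed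
  have "\<exists>w. w \<in> H \<and> nsq w \<le> C \<and> (\<forall>(g, l)\<in>R. l = ip g w)"
  proof (rule bounded_graph_functional[of R C])
    show "R \<noteq> {}" unfolding R_def by blast
    show "g \<in> H" if "(g, l) \<in> R" for g l using that comb unfolding R_def by auto
    show "(\<lambda>x. g x + g' x, l + l') \<in> R" if gl: "(g, l) \<in> R" "(g', l') \<in> R" for g l g' l'
    proof -
      obtain A c A' c' where A: "finite A" "g = (\<lambda>x. \<Sum>i\<in>A. c i * k x i)" "l = (\<Sum>i\<in>A. c i * cnj (v i))"
        and A': "finite A'" "g' = (\<lambda>x. \<Sum>i\<in>A'. c' i * k x i)" "l' = (\<Sum>i\<in>A'. c' i * cnj (v i))"
        using gl unfolding R_def by auto
      obtain d where d: "\<And>f. (\<Sum>i\<in>A. c i * f i) = (\<Sum>i\<in>A \<union> A'. d i * f i)"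
        using ext[of "A \<union> A'" A c] A(1) A'(1) by blast
      obtain d' where d': "\<And>f. (\<Sum>i\<in>A'. c' i * f i) = (\<Sum>i\<in>A \<union> A'. d' i * f i)"
        using ext[of "A \<union> A'" A' c'] A(1) A'(1) by blast
      have "(\<lambda>x. g x + g' x) = (\<lambda>x. \<Sum>i\<in>A \<union> A'. (d i + d' i) * k x i)"
        "l + l' = (\<Sum>i\<in>A \<union> A'. (d i + d' i) * cnj (v i))"
        unfolding A A' d d' by (simp_all add: distrib_right sum.distrib)
      then show ?thesis unfolding R_def using A(1) A'(1)
        by (intro CollectI exI[of _ "A \<union> A'"] exI[of _ "\<lambda>i. d i + d' i"]) simp
    qed
    show "(\<lambda>x. c * g x, c * l) \<in> R" if gl: "(g, l) \<in> R" for g l c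
    proof -
      obtain A d where "finite A" "g = (\<lambda>x. \<Sum>i\<in>A. d i * k x i)" "l = (\<Sum>i\<in>A. d i * cnj (v i))"
        using gl unfolding R_def by auto
      then show ?thesis unfolding R_def
        by (intro CollectI exI[of _ A] exI[of _ "\<lambda>i. c * d i"]) (simp add: sum_distrib_left mult_ac)
    qed
    show "2 * Re l \<le> C + nsq g" if gl: "(g, l) \<in> R" for g l
    proof -
      obtain A c where A: "finite A" "g = (\<lambda>x. \<Sum>i\<in>A. c i * k x i)" "l = (\<Sum>i\<in>A. c i * cnj (v i))"
        using gl unfolding R_def by auto
      have "Re l = Re (cnj l)" by simp
      also have "cnj l = (\<Sum>x\<in>A. cnj (c x) * v x)" by (simp add: A)
      finally show ?thesis using bound[OF A(1), of c] A(2) by (simp add: nsq_def qform_kernel)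
    qed
  qed (auto split: prod.splits)
  then obtain w where w: "w \<in> H" "nsq w \<le> C" and repr: "\<And>g l. (g, l) \<in> R \<Longrightarrow> l = ip g w"
    by blast
  have "w y = v y" for y
  proof -
    have "((\<lambda>x. \<Sum>i\<in>{y}. 1 * k x i), \<Sum>i\<in>{y}. 1 * cnj (v i)) \<in> R"
      unfolding R_def by (intro CollectI exI[of _ "{y}"] exI[of _ "\<lambda>_. 1"]) simp
    then have "cnj (v y) = ip (\<lambda>x. k x y) w" using repr by fastforce
    also have "\<dots> = cnj (w y)"
      using ip_cnj[OF w(1) kernel_mem] reproducing[OF w(1)] by simp
    finally show ?thesis by simp
  qed
  then have "w = v" by blast
  then show "v \<in> H" "nsq v \<le> C" using w by auto
qed

text \<open>
  The adjoint of multiplication by \<open>\<phi>\<close> has to map \<open>k\<^sub>x\<close> to \<open>cnj (\<phi> x) k\<^sub>x\<close>; the hypothesis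
  says that this map has squared norm at most \<open>C\<close> on the span of the kernel functions.
\<close>

lemma mult_criterion:
  assumes bound: "\<And>A. finite A \<Longrightarrow> psd_on A (\<lambda>x y. k x y * (of_real C - \<phi> x * cnj (\<phi> y)))"
    and u: "u \<in> H"
  shows "(\<lambda>x. \<phi> x * u x) \<in> H" "nsq (\<lambda>x. \<phi> x * u x) \<le> C * nsq u"
proof -
  have C0: "0 \<le> C"
  proof -
    fix x
    have kxx: "0 \<le> Re (k x x)" "k x x = of_real (Re (k x x))"
      using psd_on_diag[OF psd_on_kernel[of "{x}"], of x] by auto
    have "0 \<le> Re (k x x * (of_real C - \<phi> x * cnj (\<phi> x)))"
      using psd_on_diag(1)[OF bound[of "{x}"], of x] by simp
    also have "k x x * (of_real C - \<phi> x * cnj (\<phi> x)) = of_real (Re (k x x) * (C - (cmod (\<phi> x))\<^sup>2))"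
      unfolding complex_norm_square[symmetric] by (subst kxx(2)) simp
    finally have "0 \<le> Re (k x x) * (C - (cmod (\<phi> x))\<^sup>2)" by simp
    moreover have "Re (k x x) \<noteq> 0" using kernel_diag[of x] kxx(2) by (metis of_real_0)
    ultimately have "0 \<le> C - (cmod (\<phi> x))\<^sup>2" using kxx(1) by (simp add: zero_le_mult_iff)
    moreover have "0 \<le> (cmod (\<phi> x))\<^sup>2" by simp
    ultimately show "0 \<le> C" by linarith
  qed
  have main: "2 * Re (\<Sum>x\<in>A. cnj (c x) * (\<phi> x * u x)) \<le> C * nsq u + Re (qform A k c)"
    if A: "finite A" for A c
  proof -
    define G where "G = (\<lambda>x. \<Sum>i\<in>A. (cnj (\<phi> i) * c i) * k x i)"
    have GH: "G \<in> H" unfolding G_def by (rule lin_comb_mem) (rule kernel_mem)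
    have 1: "(\<Sum>x\<in>A. cnj (c x) * (\<phi> x * u x)) = ip u G"
      unfolding G_def ip_kernel_comb[OF u] by (simp add: mult_ac)
    have "qform A (\<lambda>x y. k x y * (of_real C - \<phi> x * cnj (\<phi> y))) c
        = of_real C * qform A k c - qform A k (\<lambda>i. cnj (\<phi> i) * c i)"
      unfolding qform_def sum_distrib_left sum_subtractf[symmetric]
      by (intro sum.cong refl) (simp add: algebra_simps)
    then have 2: "nsq G \<le> C * Re (qform A k c)"
      using psd_on_nonneg[OF bound[OF A], of c] by (simp add: G_def nsq_def qform_kernel)
    have q0: "0 \<le> Re (qform A k c)" using psd_on_nonneg[OF psd_on_kernel] .
    show ?thesis
    proof (cases "C = 0")
      case True
      then have "nsq G = 0" using 2 nsq_ge_0[OF GH] by simp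
      then have "G = (\<lambda>x. 0)" using nsq_eq_0 GH by blast
      then have "ip u G = 0" using ip_cnj[OF zero_mem u] ip_zero_left[OF u] by simp
      then show ?thesis unfolding 1 using q0 True by simp
    next
      case False
      then have C: "0 < C" using C0 by simp
      define r where "r = sqrt C"
      have r: "0 < r" "r * r = C" using C by (auto simp: r_def)
      have "2 * Re (ip (\<lambda>x. of_real r * u x) (\<lambda>x. of_real (inverse r) * G x))
          \<le> nsq (\<lambda>x. of_real r * u x) + nsq (\<lambda>x. of_real (inverse r) * G x)"
        by (intro two_Re_ip_le scale_mem u GH)
      also have "\<dots> = r\<^sup>2 * nsq u + (inverse r)\<^sup>2 * nsq G"
        unfolding nsq_scale[OF u] nsq_scale[OF GH] using r by (simp add: power_inverse norm_inverse)
      also have "\<dots> \<le> r\<^sup>2 * nsq u + (inverse r)\<^sup>2 * (C * Re (qform A k c))"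
        by (intro add_left_mono mult_left_mono 2) simp
      also have "\<dots> = C * nsq u + Re (qform A k c)"
        using r C by (simp add: power2_eq_square field_simps)
      also have "ip (\<lambda>x. of_real r * u x) (\<lambda>x. of_real (inverse r) * G x) = ip u G"
        using r u GH by (simp add: ip_scale ip_scale_right scale_mem)
      finally show ?thesis unfolding 1 .
    qed
  qed
  show "(\<lambda>x. \<phi> x * u x) \<in> H" "nsq (\<lambda>x. \<phi> x * u x) \<le> C * nsq u"
    using mem_criterion[of "\<lambda>x. \<phi> x * u x" "C * nsq u"] main by auto
qed

lemma mult_criterion_contractive:
  assumes "\<And>A. finite A \<Longrightarrow> psd_on A (\<lambda>x y. k x y * (1 - \<phi> x * cnj (\<phi> y)))"
  shows "\<phi> \<in> Mult H" "mult_norm H ip \<phi> \<le> 1"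
proof -
  have m: "(\<lambda>x. \<phi> x * u x) \<in> H" "nsq (\<lambda>x. \<phi> x * u x) \<le> nsq u" if "u \<in> H" for u
    using mult_criterion[of 1 \<phi> u] assms that by auto
  show "\<phi> \<in> Mult H" unfolding Mult_def using m by blast
  show "mult_norm H ip \<phi> \<le> 1"
    unfolding mult_norm_def
  proof (rule SUP_least)
    fix f assume "f \<in> {f \<in> H. hnorm ip f \<le> 1}"
    then have f: "f \<in> H" "hnorm ip f \<le> 1" by auto
    have "hnorm ip (\<lambda>x. \<phi> x * f x) \<le> hnorm ip f"
      using m(2)[OF f(1)] by (simp add: hnorm_def nsq_def)
    then show "ennreal (hnorm ip (\<lambda>x. \<phi> x * f x)) \<le> 1"
      using f(2) by (simp add: ennreal_le_1)
  qed
qed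

end

section \<open>The McCullough--Quiggin theorem\<close>

lemma psd_on_qform_real:
  assumes "psd_on A M"
  shows "Im (qform A M c) = 0"
proof -
  have "cnj (qform A M c) = (\<Sum>i\<in>A. \<Sum>j\<in>A. cnj (c j) * M j i * c i)"
    unfolding qform_def cnj_sum
  proof (intro sum.cong refl)
    fix i j assume "i \<in> A" "j \<in> A"
    then show "cnj (cnj (c i) * M i j * c j) = cnj (c j) * M j i * c i"
      using psd_on_herm[OF assms, of i j] by simp
  qed
  also have "\<dots> = qform A M c" unfolding qform_def by (rule sum.swap)
  finally show ?thesis by (simp add: complex_eq_iff)
qed

lemma sum_blocks:
  fixes g :: "nat \<Rightarrow> 'a::comm_monoid_add"
  shows "(\<Sum>p<n * m. g p) = (\<Sum>i<n. \<Sum>a<m. g (i * m + a))"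
proof -
  have "(\<Sum>p=i * m..<i * m + m. g p) = (\<Sum>a<m. g (i * m + a))" for i
    using sum.shift_bounds_nat_ivl[of g 0 "i * m" m]
    by (simp add: add.commute lessThan_atLeast0)
  then show ?thesis by (simp flip: sum.nat_group)
qed

text \<open>
  A row \<open>w i\<close> is interpolated by a square matrix whose other rows are zero. The Pick matrix
  is then the direct sum of the Pick matrix of the rows and copies of the kernel matrix.
\<close>

lemma psd_pick_mat_row:
  assumes K: "psd_on {..<n} (\<lambda>i j. k (z i) (z j))"
    and S: "psd_on {..<n} (\<lambda>i j. k (z i) (z j) * (1 - (\<Sum>a<m. w i a * cnj (w j a))))"
  shows "psd_mat (pick_mat k m n z (\<lambda>i. mat m m (\<lambda>(a, b). if a = 0 then w i b else 0)))"
    (is "psd_mat (pick_mat k m n z ?W)")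
proof -
  let ?P = "pick_mat k m n z ?W"
  define s where "s i j = (\<Sum>a<m. w i a * cnj (w j a))" for i j
  have prodW: "(?W i * mat_adjoint (?W j)) $$ (a, b) = (if a = 0 \<and> b = 0 then s i j else 0)"
    if "a < m" "b < m" for i j a b
    using that by (simp add: mat_adjoint_def scalar_prod_def s_def mat_of_rows_index lessThan_atLeast0)
  have entry: "?P $$ (i * m + a, j * m + b)
      = (if a = b then k (z i) (z j) * (1 - (if a = 0 then s i j else 0)) else 0)"
    if ab: "a < m" "b < m" and ij: "i < n" "j < n" for i j a b
  proof -
    have "p * m + c < n * m" if "p < n" "c < m" for p c
    proof -
      have "p * m + c < Suc p * m" using that by simp
      also have "\<dots> \<le> n * m" using that by (intro mult_le_mono1) simp
      finally show ?thesis .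
    qed
    then have lt: "i * m + a < n * m" "j * m + b < n * m" using ab ij by auto
    have dm: "(i * m + a) div m = i" "(i * m + a) mod m = a" "(j * m + b) div m = j" "(j * m + b) mod m = b"
      using ab by simp_all
    have dimX: "dim_row (?W i * mat_adjoint (?W j)) = m" "dim_col (?W i * mat_adjoint (?W j)) = m"
      by (simp_all add: mat_adjoint_def)
    have "?P $$ (i * m + a, j * m + b)
        = (k (z i) (z j) \<cdot>\<^sub>m (1\<^sub>m m - ?W i * mat_adjoint (?W j))) $$ (a, b)"
      using lt unfolding pick_mat_def by (simp only: index_mat split_conv dm)
    also have "\<dots> = k (z i) (z j) * (1\<^sub>m m $$ (a, b) - (?W i * mat_adjoint (?W j)) $$ (a, b))"
      using ab dimX by (simp del: index_mult_mat)
    finally show ?thesis using ab prodW[OF ab, of i j] by simp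
  qed
  have dims: "dim_row ?P = n * m" "dim_col ?P = n * m" by (simp_all add: pick_mat_def)
  have "0 \<le> (?P *\<^sub>v v) \<bullet>c v" if v: "v \<in> carrier_vec (n * m)" for v
  proof -
    define V where "V i a = v $ (i * m + a)" for i a
    define N where "N a = (\<lambda>i j. k (z i) (z j) * (1 - (if a = 0 then s i j else 0)))" for a :: nat
    have N: "psd_on {..<n} (N a)" for a
      using K S by (cases "a = 0") (simp_all add: N_def s_def)
    have "(?P *\<^sub>v v) \<bullet>c v = (\<Sum>p<n * m. (\<Sum>q<n * m. ?P $$ (p, q) * v $ q) * cnj (v $ p))"
      using v dims by (simp add: scalar_prod_def lessThan_atLeast0)
    also have "\<dots> = (\<Sum>i<n. \<Sum>a<m. (\<Sum>j<n. \<Sum>b<m. ?P $$ (i * m + a, j * m + b) * V j b) * cnj (V i a))"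
      unfolding sum_blocks V_def ..
    also have "\<dots> = (\<Sum>i<n. \<Sum>a<m. (\<Sum>j<n. N a i j * V j a) * cnj (V i a))"
    proof (intro sum.cong refl arg_cong2[where f = "(*)"])
      fix i a j assume *: "i \<in> {..<n}" "a \<in> {..<m}" "j \<in> {..<n}"
      have "(\<Sum>b<m. ?P $$ (i * m + a, j * m + b) * V j b) = (\<Sum>b<m. if a = b then N a i j * V j b else 0)"
        by (intro sum.cong refl) (use * entry in \<open>simp add: N_def\<close>)
      then show "(\<Sum>b<m. ?P $$ (i * m + a, j * m + b) * V j b) = N a i j * V j a"
        using * by simp
    qed
    also have "\<dots> = (\<Sum>a<m. \<Sum>i<n. (\<Sum>j<n. N a i j * V j a) * cnj (V i a))"
      by (rule sum.swap)
    also have "\<dots> = (\<Sum>a<m. qform {..<n} (N a) (\<lambda>i. V i a))"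
      unfolding qform_def sum_distrib_right by (intro sum.cong refl) (simp add: mult_ac)
    finally show ?thesis
      using psd_on_nonneg[OF N] psd_on_qform_real[OF N]
      by (simp add: less_eq_complex_def sum_nonneg)
  qed
  then show ?thesis unfolding psd_mat_def using dims by simp
qed

context rkhs
begin

lemma mult_comb_mem:
  assumes "\<And>a. a \<in> A \<Longrightarrow> \<phi> a \<in> Mult H" "\<And>a. a \<in> A \<Longrightarrow> F a \<in> H"
  shows "(\<lambda>x. \<Sum>a\<in>A. \<phi> a x * F a x) \<in> H"
  by (rule sum_mem) (use assms in \<open>auto simp: Mult_def\<close>)

text \<open>
  One component of the image of a tuple under a contractive matrix of multipliers.
  The supremum in the operator norm is over the unit ball, so the tuple has to be normalized;
  a tuple of norm zero vanishes.
\<close>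

lemma mat_mult_norm_row_bound:
  assumes \<Phi>: "\<Phi> \<in> carrier_mat m m" "elements_mat \<Phi> \<subseteq> Mult H" "mat_mult_norm H ip \<Phi> \<le> 1"
    and i: "i < m" and F: "\<And>a. a < m \<Longrightarrow> F a \<in> H"
  shows "(\<lambda>x. \<Sum>a<m. (\<Phi> $$ (i, a)) x * F a x) \<in> H"
    and "nsq (\<lambda>x. \<Sum>a<m. (\<Phi> $$ (i, a)) x * F a x) \<le> (\<Sum>a<m. nsq (F a))"
proof -
  have ent: "\<Phi> $$ (b, a) \<in> Mult H" if "a < m" "b < m" for a b
    using \<Phi>(1,2) that by auto
  have comp: "(\<lambda>x. \<Sum>a<m. (\<Phi> $$ (b, a)) x * F' a x) \<in> H"
    if "\<And>a. a < m \<Longrightarrow> F' a \<in> H" "b < m" for F' b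
    by (rule mult_comb_mem) (use ent that in auto)
  define U where "U = (\<lambda>x. \<Sum>a<m. (\<Phi> $$ (i, a)) x * F a x)"
  show UH: "U \<in> H" unfolding U_def by (rule comp) (use i F in auto)
  define T where "T = (\<Sum>a<m. nsq (F a))"
  have T0: "0 \<le> T" unfolding T_def using F nsq_ge_0 by (intro sum_nonneg) auto
  show "nsq U \<le> T"
  proof (cases "T = 0")
    case True
    then have "\<forall>a\<in>{..<m}. nsq (F a) = 0"
      unfolding T_def using F nsq_ge_0 by (subst (asm) sum_nonneg_eq_0_iff) auto
    then have "F a = (\<lambda>x. 0)" if "a < m" for a using nsq_eq_0 F that by blast
    then have "U = (\<lambda>x. 0)" unfolding U_def by (intro ext sum.neutral) auto
    then show ?thesis using True ip_zero_left[OF zero_mem] by (simp add: nsq_def)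
  next
    case False
    define r where "r = inverse (sqrt T)"
    have r: "r\<^sup>2 * T = 1" "0 < r" using False T0 by (simp_all add: r_def power_inverse)
    define G where "G = vec m (\<lambda>a x. of_real r * F a x)"
    have "tuple_norm ip G = sqrt (\<Sum>a<m. r\<^sup>2 * nsq (F a))"
      unfolding tuple_norm_def G_def using F r
      by (auto simp: hnorm_sq scale_mem nsq_scale intro!: sum.cong)
    also have "\<dots> = 1" using r by (simp add: T_def flip: sum_distrib_left)
    finally have "G \<in> {F \<in> carrier_vec (dim_col \<Phi>). (\<forall>j<dim_col \<Phi>. F $ j \<in> H) \<and> tuple_norm ip F \<le> 1}"
      using \<Phi>(1) F by (auto simp: G_def scale_mem)
    then have "ennreal (tuple_norm ip (mat_mult_op \<Phi> G)) \<le> mat_mult_norm H ip \<Phi>"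
      unfolding mat_mult_norm_def by (rule SUP_upper)
    then have "ennreal (tuple_norm ip (mat_mult_op \<Phi> G)) \<le> 1" using \<Phi>(3) by (rule order_trans)
    then have le1: "(\<Sum>b<m. (hnorm ip (mat_mult_op \<Phi> G $ b))\<^sup>2) \<le> 1"
      unfolding tuple_norm_def using \<Phi>(1) by (simp add: mat_mult_op_def)
    have "mat_mult_op \<Phi> G $ i = (\<lambda>x. of_real r * U x)"
      using \<Phi>(1) i unfolding mat_mult_op_def G_def U_def
      by (auto simp: sum_distrib_left mult_ac intro!: ext sum.cong)
    then have "r\<^sup>2 * nsq U = (hnorm ip (mat_mult_op \<Phi> G $ i))\<^sup>2"
      using UH r by (simp add: hnorm_sq scale_mem nsq_scale)
    also have "\<dots> \<le> (\<Sum>b<m. (hnorm ip (mat_mult_op \<Phi> G $ b))\<^sup>2)"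
      by (rule member_le_sum) (use i in auto)
    also have "\<dots> \<le> r\<^sup>2 * T" using le1 r by simp
    finally show ?thesis using r(2) by simp
  qed
qed

text \<open>
  Let \<open>\<Phi>\<close> be a contractive solution of the Pick problem. Multiplication by \<open>\<Phi>\<close> leaves the
  functions vanishing at \<open>u\<close> invariant, and \<open>\<kappa> j\<close> below is their reproducing kernel at \<open>z j\<close>.
  For \<open>G = \<Sum>\<^sub>j c\<^sub>j \<kappa>\<^sub>j\<close> let \<open>F\<close> be the adjoint of the row of multipliers
  applied to \<open>G\<close>, and let \<open>U\<close> be that row applied to \<open>F\<close>. Then \<open>\<langle>U, G\<rangle> = \<parallel>F\<parallel>\<^sup>2\<close> and \<open>\<parallel>U\<parallel> \<le> \<parallel>F\<parallel>\<close>, so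
  \<open>0 \<le> \<parallel>G - U\<parallel>\<^sup>2 \<le> \<parallel>G\<parallel>\<^sup>2 - \<parallel>F\<parallel>\<^sup>2\<close>, and the right-hand side is the quadratic form in question.
\<close>

lemma pick_compression_indexed:
  fixes m :: nat and w :: "nat \<Rightarrow> nat \<Rightarrow> complex"
  assumes cp: "complete_pick H ip k" and m: "0 < m"
    and psd: "psd_on {..<n} (\<lambda>i j. k (z i) (z j) * (1 - (\<Sum>a<m. w i a * cnj (w j a))))"
  shows "psd_on {..<n} (\<lambda>i j. (k (z i) (z j) - k (z i) u * k u (z j) / k u u)
                               * (1 - (\<Sum>a<m. w i a * cnj (w j a))))"
proof -
  define W where "W i = mat m m (\<lambda>(a, b). if a = 0 then w i b else 0)" for i
  have K: "psd_on {..<n} (\<lambda>i j. k (z i) (z j))"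
    using psd_on_gram(1)[of "{..<n}" "\<lambda>i x. k x (z i)"] by (simp add: kernel_mem reproducing)
  have "psd_mat (pick_mat k m n z W)"
    unfolding W_def by (rule psd_pick_mat_row[where z = z and k = k]) (rule K psd)+
  then obtain \<Phi> where \<Phi>: "\<Phi> \<in> carrier_mat m m" "elements_mat \<Phi> \<subseteq> Mult H" "mat_mult_norm H ip \<Phi> \<le> 1"
    and interp: "\<And>i. i < n \<Longrightarrow> map_mat (\<lambda>\<phi>. \<phi> (z i)) \<Phi> = W i"
    using cp unfolding complete_pick_def by (metis W_def mat_carrier)
  have \<Phi>w: "(\<Phi> $$ (0, a)) (z i) = w i a" if "i < n" "a < m" for i a
  proof -
    have "(\<Phi> $$ (0, a)) (z i) = map_mat (\<lambda>\<phi>. \<phi> (z i)) \<Phi> $$ (0, a)"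
      using \<Phi>(1) m that by auto
    then show ?thesis using interp[OF that(1)] m that by (simp add: W_def)
  qed
  define \<kappa> where "\<kappa> j = (\<lambda>x. k x (z j) - k u (z j) / k u u * k x u)" for j
  have \<kappa>H: "\<kappa> j \<in> H" for j
    unfolding \<kappa>_def by (intro diff_mem scale_mem kernel_mem)
  have \<kappa>u: "\<kappa> j u = 0" for j using kernel_diag[of u] by (simp add: \<kappa>_def)
  have repr: "ip f (\<kappa> j) = f (z j)" if "f \<in> H" "f u = 0" for f j
  proof -
    have "ip f (\<lambda>x. k x (z j) - c * k x u) = f (z j) - cnj c * f u" for c
      using that(1) by (simp add: ip_diff_right ip_scale_right scale_mem kernel_mem reproducing)
    then show ?thesis using that by (simp only: \<kappa>_def) simp
  qed
  define s where "s i j = (\<Sum>a<m. w i a * cnj (w j a))" for i j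
  define M where "M = (\<lambda>i j. \<kappa> j (z i) * (1 - s i j))"
  have "psd_on {..<n} M"
  proof (rule psd_onI)
    fix i j
    have "\<kappa> i (z j) = cnj (\<kappa> j (z i))"
      using repr[OF \<kappa>H \<kappa>u] ip_cnj[OF \<kappa>H \<kappa>H] by metis
    moreover have "s j i = cnj (s i j)" by (simp add: s_def mult_ac)
    ultimately show "M j i = cnj (M i j)" by (simp add: M_def)
  next
    fix c :: "nat \<Rightarrow> complex"
    define F where "F a = (\<lambda>x. \<Sum>j<n. (cnj (w j a) * c j) * \<kappa> j x)" for a
    define U where "U = (\<lambda>x. \<Sum>a<m. (\<Phi> $$ (0, a)) x * F a x)"
    define G where "G = (\<lambda>x. \<Sum>j<n. c j * \<kappa> j x)"
    have FH: "F a \<in> H" for a unfolding F_def by (rule lin_comb_mem) (rule \<kappa>H)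
    have GH: "G \<in> H" unfolding G_def by (rule lin_comb_mem) (rule \<kappa>H)
    have UH: "U \<in> H" and Ule: "nsq U \<le> (\<Sum>a<m. nsq (F a))"
      unfolding U_def using mat_mult_norm_row_bound[OF \<Phi> m, of F] FH by auto
    have Fu: "F a u = 0" for a by (simp add: F_def \<kappa>u)
    have Uu: "U u = 0" by (simp add: U_def Fu)
    have UG: "ip U G = (\<Sum>a<m. ip (F a) (F a))"
    proof -
      have "ip U G = (\<Sum>i<n. cnj (c i) * U (z i))"
        unfolding G_def using repr[OF UH Uu] by (simp add: ip_lin_right \<kappa>H UH)
      also have "\<dots> = (\<Sum>i<n. \<Sum>a<m. cnj (c i) * w i a * F a (z i))"
        unfolding U_def sum_distrib_left by (intro sum.cong refl) (simp add: \<Phi>w)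
      also have "\<dots> = (\<Sum>a<m. \<Sum>i<n. cnj (c i) * w i a * F a (z i))" by (rule sum.swap)
      also have "\<dots> = (\<Sum>a<m. ip (F a) (F a))"
      proof (rule sum.cong[OF refl])
        fix a
        have "ip (F a) (F a) = ip (F a) (\<lambda>x. \<Sum>j<n. (cnj (w j a) * c j) * \<kappa> j x)"
          by (simp add: F_def)
        also have "\<dots> = (\<Sum>j<n. cnj (cnj (w j a) * c j) * F a (z j))"
          by (subst ip_lin_right) (simp_all add: \<kappa>H FH repr[OF FH Fu])
        finally show "(\<Sum>i<n. cnj (c i) * w i a * F a (z i)) = ip (F a) (F a)"
          by (simp add: mult_ac)
      qed
      finally show ?thesis .
    qed
    have "qform {..<n} M c = ip G G - (\<Sum>a<m. ip (F a) (F a))"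
    proof -
      have "ip G G = qform {..<n} (\<lambda>i j. \<kappa> j (z i)) c"
        unfolding G_def using psd_on_gram(2)[of "{..<n}" \<kappa> c] by (simp add: \<kappa>H repr \<kappa>u)
      moreover have "(\<Sum>a<m. ip (F a) (F a))
          = qform {..<n} (\<lambda>i j. \<kappa> j (z i) * s i j) c"
      proof -
        have "ip (F a) (F a) = (\<Sum>i<n. \<Sum>j<n. cnj (c i) * (\<kappa> j (z i) * (w i a * cnj (w j a))) * c j)" for a
          unfolding F_def using psd_on_gram(2)[of "{..<n}" \<kappa> "\<lambda>j. cnj (w j a) * c j"]
          by (simp add: \<kappa>H repr \<kappa>u qform_def mult_ac)
        then have "(\<Sum>a<m. ip (F a) (F a))
            = (\<Sum>a<m. \<Sum>i<n. \<Sum>j<n. cnj (c i) * (\<kappa> j (z i) * (w i a * cnj (w j a))) * c j)" by simp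
        also have "\<dots> = (\<Sum>i<n. \<Sum>a<m. \<Sum>j<n. cnj (c i) * (\<kappa> j (z i) * (w i a * cnj (w j a))) * c j)"
          by (rule sum.swap)
        also have "\<dots> = (\<Sum>i<n. \<Sum>j<n. \<Sum>a<m. cnj (c i) * (\<kappa> j (z i) * (w i a * cnj (w j a))) * c j)"
          by (rule sum.cong[OF refl], rule sum.swap)
        finally show ?thesis
          unfolding qform_def s_def sum_distrib_left sum_distrib_right .
      qed
      ultimately show ?thesis
        unfolding M_def qform_def by (simp add: sum_subtractf algebra_simps)
    qed
    then have "Re (qform {..<n} M c) = nsq G - (\<Sum>a<m. nsq (F a))" by (simp add: nsq_def)
    moreover have "2 * Re (ip U G) \<le> nsq U + nsq G" by (rule two_Re_ip_le[OF UH GH])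
    moreover have "Re (ip U G) = (\<Sum>a<m. nsq (F a))" by (simp add: UG nsq_def)
    ultimately show "0 \<le> Re (qform {..<n} M c)" using Ule by simp
  qed
  then show ?thesis
    by (rule psd_on_cong) (simp add: M_def s_def \<kappa>_def mult_ac)
qed

lemma pick_compression:
  assumes cp: "complete_pick H ip k" and fin: "finite A"
    and B: "psd_on A B"
    and psd: "psd_on A (\<lambda>x y. k x y * (1 - B x y))"
  shows "psd_on A (\<lambda>x y. (k x y - k x u * k u y / k u u) * (1 - B x y))"
proof -
  obtain e where "bij_betw e {0..<card A} A" using ex_bij_betw_nat_finite[OF fin] by blast
  then have e: "bij_betw e {..<card A} A" by (simp add: lessThan_atLeast0)
  have eA: "e i \<in> A" if "i < card A" for i using e that by (auto simp: bij_betw_def)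
  obtain m w where w: "\<And>x y. x \<in> A \<Longrightarrow> y \<in> A \<Longrightarrow> B x y = (\<Sum>a<(m::nat). w x a * cnj (w y a))"
    using psd_on_factorization[OF fin B] by blast
  \<comment> \<open>One column of zeros is added, since the length of the rows has to be positive.\<close>
  define w' where "w' i a = (if a < m then w (e i) a else 0)" for i a
  have w': "B (e i) (e j) = (\<Sum>a<Suc m. w' i a * cnj (w' j a))" if "i < card A" "j < card A" for i j
    using w[OF eA eA, OF that] by (simp add: w'_def)
  have "psd_on {..<card A} (\<lambda>i j. k (e i) (e j) * (1 - B (e i) (e j)))"
    by (intro psd_on_image[OF bij_betw_inv_into[OF e]] psd_on_cong[OF psd])
       (auto simp: bij_betw_inv_into_right[OF e])
  then have "psd_on {..<card A} (\<lambda>i j. k (e i) (e j) * (1 - (\<Sum>a<Suc m. w' i a * cnj (w' j a))))"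
    by (rule psd_on_cong) (simp add: w' del: sum.lessThan_Suc)
  from pick_compression_indexed[OF cp zero_less_Suc this, of u]
  have "psd_on {..<card A} (\<lambda>i j. (k (e i) (e j) - k (e i) u * k u (e j) / k u u) * (1 - B (e i) (e j)))"
    by (rule psd_on_cong) (simp_all add: w' del: sum.lessThan_Suc)
  then show ?thesis by (rule psd_on_image[OF e])
qed

text \<open>
  If \<open>k x y = 0\<close>, the values \<open>1\<close> at \<open>x\<close> and \<open>-1\<close> at \<open>y\<close> satisfy the Pick condition. But a
  contractive multiplier attaining a value of modulus \<open>1\<close> at \<open>x\<close> takes the same value at \<open>x0\<close>, because
  \<open>k x x0 \<noteq> 0\<close>; here this shows up as a failure of positivity after compression at \<open>x0\<close>.
\<close>

lemma kernel_nonzero: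
  assumes cp: "complete_pick H ip k" and norm: "normalized_at k x0"
  shows "k x y \<noteq> 0"
proof
  assume z: "k x y = 0"
  then have z': "k y x = 0" using kernel_herm[of y x] by simp
  have ne: "x \<noteq> y" using z kernel_diag by auto
  have n: "k a x0 = 1" "k x0 a = 1" for a
    using norm kernel_herm[of x0 a] by (simp_all add: normalized_at_def)
  define s where "s = (\<lambda>a. if a = x then 1 else -1 :: complex)"
  have "psd_on {x, y} (\<lambda>a b. k a b * (1 - s a * cnj (s b)))"
    by (rule psd_onI) (use z z' ne in \<open>auto simp: s_def qform_def\<close>)
  from pick_compression[OF cp _ psd_on_rank_one this, of x0]
  have "psd_on {x, y} (\<lambda>a b. (k a b - 1) * (1 - s a * cnj (s b)))" by (simp add: n)
  from psd_on_nonneg[OF this, of "\<lambda>_. 1"] show False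
    using z z' ne by (simp add: s_def qform_def)
qed

text \<open>
  The base point \<open>u\<close> has to be arbitrary in the induction: the step for \<open>insert a A\<close> and \<open>u\<close> uses
  the hypothesis for \<open>A\<close> and base point \<open>a\<close>. That hypothesis makes \<open>B\<close> below positive,
  with row and column zero at \<open>a\<close>, and the Pick matrix \<open>k (1 - B) = k(\<cdot>, a) k(a, \<cdot>)/k(a, a)\<close> has rank
  one. Dividing its compression at \<open>u\<close> by the two factors of the rank one matrix gives the claim.
\<close>

lemma mccullough_quiggin:
  assumes cp: "complete_pick H ip k" and norm: "normalized_at k x0" and fin: "finite A"
  shows "psd_on A (\<lambda>x y. 1 - k x u * k u y / (k x y * k u u))"
  using fin
proof (induction A arbitrary: u rule: finite_induct)
  case empty
  show ?case by (rule psd_onI) (simp_all add: qform_def)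
next
  case (insert a A)
  let ?A = "insert a A"
  note nz = kernel_nonzero[OF cp norm]
  define B where "B = (\<lambda>x y. 1 - k x a * k a y / (k x y * k a a))"
  have fin: "finite ?A" using insert by simp
  define d where "d = Re (k a a)"
  have d: "k a a = of_real d" "0 < d"
  proof -
    have "0 \<le> d" "k a a = of_real d"
      using psd_on_diag[OF psd_on_kernel[of "{a}"], of a] by (auto simp: d_def)
    then show "k a a = of_real d" "0 < d" using kernel_diag[of a] by (auto simp: less_le)
  qed
  have B: "psd_on ?A B"
  proof (rule psd_on_extend_zero[of A])
    show "psd_on A B" unfolding B_def by (rule insert.IH)
    show "B x y = 0" if "x \<in> ?A - A \<or> y \<in> ?A - A" for x y
      using that nz[of a a] nz[of x y] nz[of a y] nz[of x a] by (auto simp: B_def)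
  qed (use insert in auto)
  have kB: "k x y * (1 - B x y) = of_real (1 / d) * (k x a * cnj (k y a))" for x y
    using nz[of x y] d kernel_herm[of a y] by (simp add: B_def field_simps)
  have "psd_on ?A (\<lambda>x y. k x y * (1 - B x y))"
    unfolding kB using d by (intro psd_on_scale psd_on_rank_one) simp
  from pick_compression[OF cp fin B this, of u]
  have "psd_on ?A (\<lambda>x y. (k x y - k x u * k u y / k u u) * (1 - B x y))" .
  from psd_on_scale[OF psd_on_congruence[OF this, of "\<lambda>x. 1 / k x a"], of d]
  show ?case
  proof (rule psd_on_cong)
    show "0 \<le> d" using d by simp
    fix x y
    have [simp]: "cnj (k y a) = k a y" using kernel_herm[of a y] by simp
    show "1 - k x u * k u y / (k x y * k u u)
      = of_real d * (1 / k x a * ((k x y - k x u * k u y / k u u) * (1 - B x y)) * cnj (1 / k y a))"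
      using d nz[of x y] nz[of u u] nz[of x a] nz[of a y] by (simp add: B_def field_simps)
  qed
qed

end

section \<open>The Sarason function\<close>

locale normalized_complete_pick = rkhs +
  fixes x0 :: 'a
  assumes complete_pick: "complete_pick H ip k"
    and normalized: "normalized_at k x0"
begin

text \<open>
  A factorization \<open>B(x, y) = \<langle>b(x), b(y)\<rangle>\<close> would exhibit \<open>k = 1/(1 - B)\<close> as a pullback of the
  kernel of the Drury--Arveson space along \<open>b\<close>.
\<close>

definition B :: "'a \<Rightarrow> 'a \<Rightarrow> complex" where
  "B x y = 1 - 1 / k x y"

lemma k_nonzero: "k x y \<noteq> 0"
  using kernel_nonzero[OF complete_pick normalized] .

lemma k_base: "k x x0 = 1" "k x0 x = 1"
  using normalized kernel_herm[of x0 x] by (simp_all add: normalized_at_def)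

lemma psd_on_B: "finite A \<Longrightarrow> psd_on A B"
  using mccullough_quiggin[OF complete_pick normalized, of A x0]
  by (rule psd_on_cong) (simp_all add: B_def k_base)

lemma B_herm: "cnj (B x y) = B y x"
  using kernel_herm[of y x] by (simp add: B_def)

lemma B_times_k: "B x y * k x y = k x y - 1"
  using k_nonzero[of x y] by (simp add: B_def field_simps)

text \<open>
  Positivity of \<open>B\<close>, applied to the tuple \<open>u\<^sub>j - c\<^sub>j k\<^sub>j\<close> of vectors (Schur product with its
  Gram matrix), added to \<open>0 \<le> |\<alpha> - \<Sum> c|\<^sup>2\<close>. The terms quadratic in \<open>c\<close> combine to
  \<open>\<Sum> c\<^sub>i\<^sup>* (1 + B k) c\<^sub>j = \<Sum> c\<^sub>i\<^sup>* k c\<^sub>j\<close>, as required by the membership criterion.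
\<close>

lemma row_contraction_dual:
  assumes fin: "finite E" and u: "\<And>j. j \<in> E \<Longrightarrow> u j \<in> H"
  shows "2 * Re (\<Sum>x\<in>E. cnj (c x) * (\<alpha> + (\<Sum>j\<in>E. B x j * u j x)))
    \<le> (cmod \<alpha>)\<^sup>2 + Re (\<Sum>i\<in>E. \<Sum>j\<in>E. B i j * ip (u j) (u i)) + Re (qform E k c)"
proof -
  define Y where "Y j = (\<lambda>x. u j x - c j * k x j)" for j
  define s where "s = (\<Sum>i\<in>E. c i)"
  define X where "X = (\<Sum>i\<in>E. \<Sum>j\<in>E. cnj (c i) * (B i j * u j i))"
  have YH: "Y j \<in> H" if "j \<in> E" for j
    unfolding Y_def using u that by (intro diff_mem scale_mem kernel_mem) auto
  have "psd_on E (\<lambda>i j. B i j * ip (Y j) (Y i))"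
    by (intro psd_on_schur_product psd_on_gram psd_on_B fin YH)
  from psd_on_nonneg[OF this, of "\<lambda>_. 1"]
  have pos: "0 \<le> Re (\<Sum>i\<in>E. \<Sum>j\<in>E. B i j * ip (Y j) (Y i))" by (simp add: qform_def)
  have "B i j * ip (Y j) (Y i) = B i j * ip (u j) (u i) - cnj (c i) * (B i j * u j i)
      - cnj (cnj (c j) * (B j i * u i j)) + cnj (c i) * k i j * c j - cnj (c i) * c j"
    if "i \<in> E" "j \<in> E" for i j
  proof -
    have sk: "(\<lambda>x. c j * k x j) \<in> H" "(\<lambda>x. c i * k x i) \<in> H" by (intro scale_mem kernel_mem)+
    have 1: "ip (\<lambda>x. c j * k x j) (u i) = c j * cnj (u i j)"
      using u[OF that(1)] ip_cnj[OF u[OF that(1)] kernel_mem[of j]]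
      by (simp add: ip_scale kernel_mem reproducing)
    have 2: "ip (Y j) (Y i) = ip (u j) (u i) - cnj (c i) * u j i - c j * cnj (u i j)
        + c j * cnj (c i) * k i j"
      unfolding Y_def using u that sk 1
      by (simp add: ip_diff ip_diff_right diff_mem ip_scale ip_scale_right kernel_mem reproducing scale_mem)
    have "B i j * ip (Y j) (Y i) = B i j * ip (u j) (u i) - cnj (c i) * (B i j * u j i)
      - c j * (B i j * cnj (u i j)) + cnj (c i) * (B i j * k i j) * c j"
      unfolding 2 by (simp add: algebra_simps)
    then show ?thesis unfolding B_times_k by (simp add: B_herm algebra_simps)
  qed
  then have "(\<Sum>i\<in>E. \<Sum>j\<in>E. B i j * ip (Y j) (Y i))
    = (\<Sum>i\<in>E. \<Sum>j\<in>E. B i j * ip (u j) (u i) - cnj (c i) * (B i j * u j i)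
      - cnj (cnj (c j) * (B j i * u i j)) + cnj (c i) * k i j * c j - cnj (c i) * c j)"
    by (intro sum.cong refl) blast
  also have "\<dots> = (\<Sum>i\<in>E. \<Sum>j\<in>E. B i j * ip (u j) (u i)) - X
      - (\<Sum>i\<in>E. \<Sum>j\<in>E. cnj (cnj (c j) * (B j i * u i j))) + qform E k c
      - (\<Sum>i\<in>E. \<Sum>j\<in>E. cnj (c i) * c j)"
    unfolding X_def qform_def by (simp only: sum_subtractf sum.distrib)
  also have "(\<Sum>i\<in>E. \<Sum>j\<in>E. cnj (cnj (c j) * (B j i * u i j))) = cnj X"
    unfolding X_def cnj_sum by (rule sum.swap)
  also have "(\<Sum>i\<in>E. \<Sum>j\<in>E. cnj (c i) * c j) = s * cnj s"
    unfolding s_def cnj_sum by (subst mult.commute) (simp add: sum_product)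
  also have "s * cnj s = of_real ((cmod s)\<^sup>2)" by (rule complex_norm_square[symmetric])
  finally have form: "Re (\<Sum>i\<in>E. \<Sum>j\<in>E. B i j * ip (Y j) (Y i))
    = Re (\<Sum>i\<in>E. \<Sum>j\<in>E. B i j * ip (u j) (u i)) - 2 * Re X + Re (qform E k c) - (cmod s)\<^sup>2"
    by simp
  have "(\<Sum>x\<in>E. cnj (c x) * (\<alpha> + (\<Sum>j\<in>E. B x j * u j x))) = \<alpha> * cnj s + X"
    unfolding s_def X_def cnj_sum sum_distrib_left sum.distrib[symmetric]
    by (intro sum.cong refl) (simp add: distrib_left sum_distrib_left mult.commute)
  moreover have "0 \<le> (cmod (\<alpha> - s))\<^sup>2" by simp
  moreover have "(cmod (\<alpha> - s))\<^sup>2 = (cmod \<alpha>)\<^sup>2 + (cmod s)\<^sup>2 - 2 * Re (\<alpha> * cnj s)"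
    unfolding cmod_power2 by (simp add: power2_eq_square algebra_simps)
  ultimately show ?thesis using pos form by simp
qed

text \<open>
  The points \<open>D\<close> at which a function is tested and the indices \<open>A\<close> of the tuple are unrelated;
  extending \<open>u\<close> and \<open>c\<close> by zero to \<open>A \<union> D\<close> reduces the claim to the previous lemma.
\<close>

lemma row_contraction:
  assumes fin: "finite A" and u: "\<And>j. j \<in> A \<Longrightarrow> u j \<in> H"
  shows "(\<lambda>x. \<alpha> + (\<Sum>j\<in>A. B x j * u j x)) \<in> H"
    and "nsq (\<lambda>x. \<alpha> + (\<Sum>j\<in>A. B x j * u j x))
      \<le> (cmod \<alpha>)\<^sup>2 + Re (\<Sum>i\<in>A. \<Sum>j\<in>A. B i j * ip (u j) (u i))"
proof -
  define v where "v = (\<lambda>x. \<alpha> + (\<Sum>j\<in>A. B x j * u j x))"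
  define S where "S = (\<Sum>i\<in>A. \<Sum>j\<in>A. B i j * ip (u j) (u i))"
  have "2 * Re (\<Sum>x\<in>D. cnj (c x) * v x) \<le> ((cmod \<alpha>)\<^sup>2 + Re S) + Re (qform D k c)"
    if D: "finite D" for D c
  proof -
    define E where "E = A \<union> D"
    define u' where "u' j = (if j \<in> A then u j else (\<lambda>x. 0))" for j
    define c' where "c' x = (if x \<in> D then c x else 0)" for x
    have E: "finite E" "A \<subseteq> E" "D \<subseteq> E" using fin D by (auto simp: E_def)
    have u': "u' j \<in> H" for j using u zero_mem by (simp add: u'_def)
    have 1: "(\<Sum>j\<in>E. B x j * u' j x) = (\<Sum>j\<in>A. B x j * u j x)" for x
      by (rule sum.mono_neutral_cong_right) (use E in \<open>auto simp: u'_def\<close>)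
    have vx: "\<alpha> + (\<Sum>j\<in>A. B x j * u j x) = v x" for x by (simp add: v_def)
    have 2: "(\<Sum>x\<in>E. cnj (c' x) * v x) = (\<Sum>x\<in>D. cnj (c x) * v x)"
      by (rule sum.mono_neutral_cong_right) (use E in \<open>auto simp: c'_def\<close>)
    have zl: "ip (\<lambda>x. 0) h = 0" "ip h (\<lambda>x. 0) = 0" if "h \<in> H" for h
      using ip_zero_left[OF that] ip_cnj[OF zero_mem that] by simp_all
    have "(\<Sum>i\<in>E. \<Sum>j\<in>E. B i j * ip (u' j) (u' i)) = (\<Sum>i\<in>E. \<Sum>j\<in>A. B i j * ip (u' j) (u' i))"
      by (intro sum.cong[OF refl] sum.mono_neutral_right) (use E u' zl in \<open>auto simp: u'_def\<close>)
    also have "\<dots> = (\<Sum>i\<in>A. \<Sum>j\<in>A. B i j * ip (u' j) (u' i))"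
      by (rule sum.mono_neutral_right) (use E u zl in \<open>auto simp: u'_def\<close>)
    also have "\<dots> = S" unfolding S_def by (intro sum.cong refl) (simp add: u'_def)
    finally have 3: "(\<Sum>i\<in>E. \<Sum>j\<in>E. B i j * ip (u' j) (u' i)) = S" .
    have "qform E k c' = qform D k c'"
      by (rule qform_supported) (use E in \<open>auto simp: c'_def\<close>)
    also have "\<dots> = qform D k c" unfolding qform_def by (intro sum.cong refl) (simp add: c'_def)
    finally have 4: "qform E k c' = qform D k c" .
    show ?thesis
      using row_contraction_dual[OF E(1), of u' c' \<alpha>, OF u'] unfolding 1 vx 2 3 4 .
  qed
  from mem_criterion[OF this] show "v \<in> H" "nsq v \<le> (cmod \<alpha>)\<^sup>2 + Re S" by blast+
qed

text \<open>
  The row contraction, applied to the combinations \<open>\<Sum> c\<^sub>j (\<alpha>\<^sub>j, p\<^sub>j)\<close>, makes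
  \<open>\<alpha>\<^sub>i\<^sup>* \<alpha>\<^sub>j + B(i, j) \<langle>p\<^sub>j, p\<^sub>i\<rangle> - \<langle>Y\<^sub>j, Y\<^sub>i\<rangle>\<close> positive. Entrywise multiplication by \<open>k\<close> turns the factor \<open>B\<close> into \<open>k - 1\<close>,
  and adding the Gram matrix of the \<open>p\<^sub>j\<close> turns it into \<open>k\<close>.
\<close>

lemma transfer_kernel_psd:
  assumes fin: "finite A" and p: "\<And>j. p j \<in> H"
    and Y: "\<And>j x. Y j x = \<alpha> j + B x j * p j x"
  shows "Y j \<in> H"
    and "psd_on A (\<lambda>i j. k i j * (cnj (\<alpha> i) * \<alpha> j + ip (p j) (p i) - ip (Y j) (Y i)))"
proof -
  show YH: "Y j \<in> H" for j
  proof -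
    have "Y j = (\<lambda>x. \<alpha> j + (\<Sum>i\<in>{j}. B x i * p i x))" by (auto simp: Y)
    then show ?thesis using row_contraction(1)[of "{j}" p "\<alpha> j"] p by simp
  qed
  define N where "N = (\<lambda>i j. cnj (\<alpha> i) * \<alpha> j + B i j * ip (p j) (p i) - ip (Y j) (Y i))"
  have N: "psd_on A N"
  proof (rule psd_onI)
    fix i j
    show "N j i = cnj (N i j)"
      unfolding N_def using ip_cnj[OF p[of i] p[of j]] ip_cnj[OF YH[of i] YH[of j]]
      by (simp add: B_herm mult.commute)
  next
    fix c :: "'a \<Rightarrow> complex"
    define a where "a = (\<Sum>j\<in>A. c j * \<alpha> j)"
    have cp: "(\<lambda>x. c j * p j x) \<in> H" for j using p scale_mem by blast
    have "(\<lambda>x. \<Sum>j\<in>A. c j * Y j x) = (\<lambda>x. a + (\<Sum>j\<in>A. B x j * (c j * p j x)))"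
      by (simp add: a_def Y sum.distrib distrib_left mult_ac)
    then have "nsq (\<lambda>x. \<Sum>j\<in>A. c j * Y j x)
        \<le> (cmod a)\<^sup>2 + Re (\<Sum>i\<in>A. \<Sum>j\<in>A. B i j * ip (\<lambda>x. c j * p j x) (\<lambda>x. c i * p i x))"
      using row_contraction(2)[OF fin, of "\<lambda>j x. c j * p j x" a] cp by simp
    moreover have "(\<Sum>i\<in>A. \<Sum>j\<in>A. B i j * ip (\<lambda>x. c j * p j x) (\<lambda>x. c i * p i x))
        = qform A (\<lambda>i j. B i j * ip (p j) (p i)) c"
      unfolding qform_def
      by (intro sum.cong refl) (simp add: ip_scale ip_scale_right p scale_mem)
    moreover have "nsq (\<lambda>x. \<Sum>j\<in>A. c j * Y j x) = Re (qform A (\<lambda>i j. ip (Y j) (Y i)) c)"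
      using psd_on_gram(2)[of A Y c] YH by (simp add: nsq_def)
    moreover have "qform A (\<lambda>i j. cnj (\<alpha> i) * \<alpha> j) c = of_real ((cmod a)\<^sup>2)"
    proof -
      have "qform A (\<lambda>i j. cnj (\<alpha> i) * \<alpha> j) c = cnj a * a"
        unfolding qform_def a_def cnj_sum sum_product by (intro sum.cong refl) simp
      then show ?thesis by (simp only: complex_norm_square mult.commute)
    qed
    moreover have "qform A N c = qform A (\<lambda>i j. cnj (\<alpha> i) * \<alpha> j) c
        + qform A (\<lambda>i j. B i j * ip (p j) (p i)) c - qform A (\<lambda>i j. ip (Y j) (Y i)) c"
      unfolding N_def qform_def sum.distrib[symmetric] sum_subtractf[symmetric]
      by (intro sum.cong refl) (simp add: distrib_left distrib_right left_diff_distrib right_diff_distrib)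
    ultimately show "0 \<le> Re (qform A N c)" by simp
  qed
  have "psd_on A (\<lambda>i j. k i j * N i j + ip (p j) (p i))"
    by (intro psd_on_add psd_on_schur_product psd_on_kernel psd_on_gram fin N p)
  then show "psd_on A (\<lambda>i j. k i j * (cnj (\<alpha> i) * \<alpha> j + ip (p j) (p i) - ip (Y j) (Y i)))"
  proof (rule psd_on_cong)
    fix i j
    have "k i j * N i j = k i j * (cnj (\<alpha> i) * \<alpha> j - ip (Y j) (Y i)) + (B i j * k i j) * ip (p j) (p i)"
      by (simp add: N_def algebra_simps)
    then show "k i j * (cnj (\<alpha> i) * \<alpha> j + ip (p j) (p i) - ip (Y j) (Y i))
        = k i j * N i j + ip (p j) (p i)"
      unfolding B_times_k by (simp add: algebra_simps)
  qed
qed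

text \<open>
  Put \<open>b = B(\<cdot>, z)\<close>, so that \<open>k(\<cdot>, z) = 1/(1 - b)\<close>. Multiplication by \<open>b\<close> has squared norm at most
  \<open>B(z, z) = t < 1\<close>, by the Schur complement of \<open>B\<close> at \<open>z\<close>. If it is bounded by \<open>\<rho> < 1\<close>, then
  \<open>1/(1 - b)\<close> is bounded by \<open>1/(1 - \<rho>)\<close>; the Neumann series is replaced by the identity
  \<open>\<rho> ((1 - b) (1 - b\<^sup>*) - (1 - \<rho>)\<^sup>2) = (\<rho> - b) (\<rho> - b\<^sup>*) + (1 - \<rho>) (\<rho>\<^sup>2 - b b\<^sup>*)\<close>.
\<close>

lemma kernel_function_mult:
  assumes f: "f \<in> H"
  shows "(\<lambda>x. k x z * f x) \<in> H"
proof -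
  define t where "t = Re (B z z)"
  define b where "b x = B x z" for x
  have Bz: "0 \<le> t" "B z z = of_real t"
    using psd_on_diag[OF psd_on_B[of "{z}"], of z] by (auto simp: t_def)
  have kz: "0 < Re (k z z)" "k z z = of_real (Re (k z z))"
  proof -
    have "0 \<le> Re (k z z)" and r: "k z z = of_real (Re (k z z))"
      using psd_on_diag[OF psd_on_kernel[of "{z}"], of z] by auto
    moreover have "Re (k z z) \<noteq> 0" using kernel_diag[of z] r by (metis of_real_0)
    ultimately show "0 < Re (k z z)" "k z z = of_real (Re (k z z))" by auto
  qed
  have t1: "t < 1"
  proof -
    have "t = 1 - 1 / Re (k z z)"
      unfolding t_def B_def by (subst kz(2)) simp
    then show ?thesis using kz(1) by simp
  qed
  \<comment> \<open>The obvious \<open>\<rho> = \<surd>t\<close> could be zero, but the identity is divided by \<open>\<rho>\<close>; this \<open>\<rho>\<close> exceeds \<open>\<surd>t\<close> and stays below \<open>1\<close>.\<close>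
  define \<rho> where "\<rho> = (1 + t) / 2"
  have \<rho>: "0 < \<rho>" "\<rho> < 1" using Bz(1) t1 by (auto simp: \<rho>_def)
  have "\<rho>\<^sup>2 - t = ((1 - t) / 2)\<^sup>2" by (simp add: \<rho>_def power2_eq_square field_simps)
  then have \<rho>t: "0 \<le> \<rho>\<^sup>2 - t" by simp
  define M where "M = 1 / (1 - \<rho>)\<^sup>2"
  have psd: "psd_on A (\<lambda>x y. k x y * (of_real M - k x z * cnj (k y z)))" if A: "finite A" for A
  proof -
    define E where "E = insert z A"
    have E: "finite E" "z \<in> E" using A by (auto simp: E_def)
    have cb: "cnj (b y) = B z y" for y by (simp add: b_def B_herm)
    have s1: "psd_on E (\<lambda>x y. of_real t * B x y - b x * cnj (b y))"
    proof (rule psd_on_cong[OF psd_on_scale[OF psd_on_schur_complement(1)[OF psd_on_B[OF E(1)] E] Bz(1)]])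
      fix x y assume xy: "x \<in> E" "y \<in> E"
      show "of_real t * B x y - b x * cnj (b y) = of_real t * (B x y - B x z * B z y / B z z)"
      proof (cases "t = 0")
        case True
        then have "B x z = 0"
          using psd_on_schur_complement(2)[OF psd_on_B[OF E(1)] E] Bz(2) xy(1) by simp
        then show ?thesis using True by (simp add: b_def)
      next
        case False
        then show ?thesis unfolding cb Bz(2) by (simp add: b_def field_simps)
      qed
    qed
    have "psd_on E (\<lambda>x y. of_real (\<rho>\<^sup>2 - t) * k x y + (of_real t * (1 * cnj 1)
        + k x y * (of_real t * B x y - b x * cnj (b y))))"
      by (intro psd_on_add psd_on_scale psd_on_kernel psd_on_schur_product E s1 \<rho>t Bz(1) psd_on_rank_one)
    then have s2: "psd_on E (\<lambda>x y. k x y * (of_real (\<rho>\<^sup>2) - b x * cnj (b y)))"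
    proof (rule psd_on_cong)
      fix x y
      have "k x y * (of_real t * B x y - b x * cnj (b y))
          = of_real t * (B x y * k x y) - k x y * (b x * cnj (b y))" by (simp add: algebra_simps)
      then show "k x y * (of_real (\<rho>\<^sup>2) - b x * cnj (b y)) = of_real (\<rho>\<^sup>2 - t) * k x y
          + (of_real t * (1 * cnj 1) + k x y * (of_real t * B x y - b x * cnj (b y)))"
        unfolding B_times_k by (simp add: algebra_simps)
    qed
    define Q where "Q = (\<lambda>x y. k x y * ((of_real \<rho> - b x) * cnj (of_real \<rho> - b y))
        + of_real (1 - \<rho>) * (k x y * (of_real (\<rho>\<^sup>2) - b x * cnj (b y))))"
    have "psd_on E Q"
      unfolding Q_def using \<rho>
      by (intro psd_on_add psd_on_schur_product psd_on_kernel psd_on_rank_one psd_on_scale s2 E) simp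
    then have "psd_on E (\<lambda>x y. of_real (M / \<rho>) * (k x z * Q x y * cnj (k y z)))"
      using \<rho> by (intro psd_on_scale psd_on_congruence) (auto simp: M_def)
    then have "psd_on E (\<lambda>x y. k x y * (of_real M - k x z * cnj (k y z)))"
    proof (rule psd_on_cong)
      fix x y
      define K L where "K = k x z" and "L = cnj (k y z)"
      have KL: "K \<noteq> 0" "L \<noteq> 0" using k_nonzero by (simp_all add: K_def L_def)
      have bK: "K * b x = K - 1" "L * cnj (b y) = L - 1"
      proof -
        show "K * b x = K - 1" using B_times_k[of x z] by (simp add: K_def b_def mult.commute)
        have "cnj (B y z * k y z) = cnj (k y z - 1)" by (simp only: B_times_k)
        then show "L * cnj (b y) = L - 1" by (simp add: L_def b_def mult.commute)
      qed
      have "K * Q x y * L = k x y * ((of_real \<rho> * K - K * b x) * (of_real \<rho> * L - L * cnj (b y))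
          + of_real (1 - \<rho>) * (of_real (\<rho>\<^sup>2) * (K * L) - (K * b x) * (L * cnj (b y))))"
        unfolding Q_def by (simp add: algebra_simps)
      also have "\<dots> = k x y * (of_real \<rho> * (1 - of_real ((1 - \<rho>)\<^sup>2) * (K * L)))"
        unfolding bK by (simp add: algebra_simps power2_eq_square)
      finally have KQL: "K * Q x y * L = k x y * (of_real \<rho> * (1 - of_real ((1 - \<rho>)\<^sup>2) * (K * L)))" .
      have MM: "M * (1 - \<rho>)\<^sup>2 = 1" using \<rho> by (simp add: M_def)
      have "of_real (M / \<rho>) * (K * Q x y * L)
          = k x y * (of_real (M / \<rho> * \<rho>) - of_real (M / \<rho> * \<rho> * (1 - \<rho>)\<^sup>2) * (K * L))"
        unfolding KQL by (simp add: algebra_simps)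
      also have "M / \<rho> * \<rho> = M" using \<rho> by simp
      finally show "k x y * (of_real M - k x z * cnj (k y z))
          = of_real (M / \<rho>) * (k x z * Q x y * cnj (k y z))"
        unfolding MM by (simp add: K_def L_def)
    qed
    then show ?thesis by (rule psd_on_subset) (auto simp: E_def A)
  qed
  show ?thesis using mult_criterion(1)[OF psd f] .
qed

text \<open>
  Both inequalities are instances of \<open>transfer_kernel_psd\<close>. With \<open>g z = k\<^sub>z f\<close> the equation
  \<open>g z - f = B(\<cdot>, z) g z\<close> gives \<open>k(i, j) (h i + cnj (h j) - 1) \<ge> 0\<close>, which shows that \<open>Re (h z) \<ge> 1/2\<close>
  and, after division by \<open>h i\<close> and \<open>cnj (h j)\<close>, is the bound for \<open>\<psi> = 1 - 1/h\<close>. For \<open>\<phi> = f/h\<close> the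
  function \<open>p z = k\<^sub>z - cnj (\<phi> z) g z\<close> is chosen orthogonal to \<open>f\<close>, and
  \<open>y z = p z + cnj (\<phi> z) f\<close> equals \<open>1 + B(\<cdot>, z) p z\<close>; by Pythagoras \<open>\<langle>y j, y i\<rangle> - \<langle>p j, p i\<rangle> = \<phi> i cnj (\<phi> j)\<close>.
\<close>

lemma sarason_function_bounds:
  assumes f: "f \<in> H" "nsq f = 1"
  defines "h \<equiv> \<lambda>z. ip f (\<lambda>x. k x z * f x)"
  assumes fin: "finite A"
  shows "h z \<noteq> 0"
    and "psd_on A (\<lambda>x y. k x y * (1 - (1 - 1 / h x) * cnj (1 - 1 / h y)))"
    and "psd_on A (\<lambda>x y. k x y * (1 - (f x / h x) * cnj (f y / h y)))"
proof -
  define g where "g z = (\<lambda>x. k x z * f x)" for z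
  have gH: "g z \<in> H" for z unfolding g_def by (rule kernel_function_mult[OF f(1)])
  have h: "h z = ip f (g z)" for z by (simp add: h_def g_def)
  have ff: "ip f f = 1" using ip_self[OF f(1)] f(2) by simp
  have gf: "ip (g z) f = cnj (h z)" for z using ip_cnj[OF f(1) gH] by (simp add: h)
  have gdiff: "g z x - f x = B x z * g z x" for z x
  proof -
    have "B x z * g z x = (B x z * k x z) * f x" by (simp add: g_def)
    then show ?thesis unfolding B_times_k by (simp add: g_def algebra_simps)
  qed
  have re: "psd_on D (\<lambda>i j. k i j * (h i + cnj (h j) - 1))" if D: "finite D" for D
  proof (rule psd_on_cong)
    define Y where "Y z = (\<lambda>x. g z x - f x)" for z
    show "psd_on D (\<lambda>i j. k i j * (cnj 0 * 0 + ip (g j) (g i) - ip (Y j) (Y i)))"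
      by (rule transfer_kernel_psd(2)[OF D gH]) (simp add: Y_def gdiff)
    fix i j
    have "ip (Y j) (Y i) = ip (g j) (g i) - h i - cnj (h j) + 1"
      unfolding Y_def using gH f(1) by (simp add: ip_diff ip_diff_right diff_mem gf h ff)
    then show "k i j * (h i + cnj (h j) - 1) = k i j * (cnj 0 * 0 + ip (g j) (g i) - ip (Y j) (Y i))"
      by simp
  qed
  have hnz: "h z \<noteq> 0" for z
  proof
    assume "h z = 0"
    then have "0 \<le> Re (- k z z)" using psd_on_diag(1)[OF re[of "{z}"], of z] by simp
    moreover have "0 \<le> Re (k z z)" "k z z = of_real (Re (k z z))"
      using psd_on_diag[OF psd_on_kernel[of "{z}"], of z] by auto
    ultimately show False using kernel_diag[of z] by (metis of_real_0 order_antisym neg_0_le_iff_le uminus_complex.sel(1))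
  qed
  show "h z \<noteq> 0" by (rule hnz)
  show "psd_on A (\<lambda>x y. k x y * (1 - (1 - 1 / h x) * cnj (1 - 1 / h y)))"
  proof (rule psd_on_cong[OF psd_on_congruence[OF re[OF fin], of "\<lambda>x. 1 / h x"]])
    fix x y
    show "k x y * (1 - (1 - 1 / h x) * cnj (1 - 1 / h y))
      = 1 / h x * (k x y * (h x + cnj (h y) - 1)) * cnj (1 / h y)"
      using hnz[of x] hnz[of y] by (simp add: field_simps)
  qed
  define \<phi> where "\<phi> x = f x / h x" for x
  define y where "y z = (\<lambda>x. k x z - cnj (\<phi> z) * (g z x - f x))" for z
  define p where "p z = (\<lambda>x. k x z - cnj (\<phi> z) * g z x)" for z
  have pH: "p z \<in> H" for z
    unfolding p_def by (intro diff_mem scale_mem kernel_mem gH)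
  have yp: "y z = (\<lambda>x. p z x + cnj (\<phi> z) * f x)" for z
    by (simp add: y_def p_def algebra_simps)
  have \<phi>h: "cnj (\<phi> z) * cnj (h z) = cnj (f z)" for z
    unfolding complex_cnj_mult[symmetric] using hnz by (simp add: \<phi>_def)
  have pf: "ip (p z) f = 0" for z
  proof -
    have "ip (\<lambda>x. k x z) f = cnj (f z)"
      using ip_cnj[OF f(1) kernel_mem[of z]] reproducing[OF f(1)] by simp
    then show ?thesis
      unfolding p_def using f(1) gH[of z]
      by (simp add: ip_diff ip_scale scale_mem kernel_mem gf \<phi>h)
  qed
  have fp: "ip f (p z) = 0" for z using ip_cnj[OF pH f(1)] pf by simp
  show "psd_on A (\<lambda>x y. k x y * (1 - (f x / h x) * cnj (f y / h y)))"
  proof (rule psd_on_cong)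
    show "psd_on A (\<lambda>i j. k i j * (cnj 1 * 1 + ip (p j) (p i) - ip (y j) (y i)))"
    proof (rule transfer_kernel_psd(2)[OF fin pH])
      fix z x
      have "B x z * p z x = (B x z * k x z) * (1 - cnj (\<phi> z) * f x)"
        by (simp add: p_def g_def algebra_simps)
      then show "y z x = 1 + B x z * p z x"
        unfolding B_times_k by (simp add: y_def g_def algebra_simps)
    qed
    fix i j
    have sf: "(\<lambda>x. c * f x) \<in> H" for c using f(1) scale_mem by blast
    have yy: "ip (y j) (y i) = ip (p j) (p i) + cnj (\<phi> j) * \<phi> i"
      unfolding yp using pH f(1) sf
      by (simp add: ip_add ip_add_right add_mem ip_scale ip_scale_right pf fp ff)
    show "k i j * (1 - f i / h i * cnj (f j / h j))
        = k i j * (cnj 1 * 1 + ip (p j) (p i) - ip (y j) (y i))"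
      unfolding yy by (simp add: \<phi>_def mult.commute)
  qed
qed

section \<open>Factorization and the Smirnov class\<close>

lemma contractive_quotient:
  assumes f: "f \<in> H"
  obtains \<phi> \<psi> where
    "\<And>A. finite A \<Longrightarrow> psd_on A (\<lambda>x y. k x y * (1 - \<phi> x * cnj (\<phi> y)))"
    "\<And>A. finite A \<Longrightarrow> psd_on A (\<lambda>x y. k x y * (1 - \<psi> x * cnj (\<psi> y)))"
    "\<psi> x0 = 0" "\<And>x. 1 - \<psi> x \<noteq> 0"
    "f = (\<lambda>x. of_real (hnorm ip f) * \<phi> x / (1 - \<psi> x))"
proof (cases "nsq f = 0")
  case True
  then have "f = (\<lambda>x. 0)" using nsq_eq_0 f by blast
  then show thesis
    using that[of "\<lambda>x. 0" "\<lambda>x. 0"] psd_on_kernel by simp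
next
  case False
  define r where "r = hnorm ip f"
  have r: "r\<^sup>2 = nsq f" "r \<noteq> 0" using False hnorm_sq[OF f] by (auto simp: r_def)
  define f' where "f' = (\<lambda>x. of_real (1 / r) * f x)"
  have f'H: "f' \<in> H" unfolding f'_def using f scale_mem by blast
  have "nsq f' = 1"
    unfolding f'_def nsq_scale[OF f] using r by (simp add: power_divide norm_divide flip: r(1))
  note bounds = sarason_function_bounds[OF f'H this]
  define h where "h z = ip f' (\<lambda>x. k x z * f' x)" for z
  have "h x0 = 1"
    using ip_self[OF f'H] \<open>nsq f' = 1\<close> by (simp add: h_def k_base)
  show thesis
  proof (rule that[of "\<lambda>x. f' x / h x" "\<lambda>x. 1 - 1 / h x"])
    have hnz: "h x \<noteq> 0" for x using bounds(1)[of "{}" x] by (simp add: h_def)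
    show "1 - 1 / h x0 = 0" using \<open>h x0 = 1\<close> by simp
    show "1 - (1 - 1 / h x) \<noteq> 0" for x using hnz[of x] by simp
    show "f = (\<lambda>x. of_real (hnorm ip f) * (f' x / h x) / (1 - (1 - 1 / h x)))"
      using hnz r(2) by (simp add: f'_def r_def[symmetric])
  qed (use bounds(2,3) in \<open>simp_all add: h_def\<close>)
qed

text \<open>
  Let \<open>w\<close> be the projection of \<open>v\<close> to the closure of \<open>(1 - \<psi>) H\<close>, obtained by representing
  \<open>\<langle>\<cdot>, v\<rangle>\<close> on that subspace. The difference \<open>d = v - w\<close> is orthogonal to \<open>(1 - \<psi>) d\<close>, hence
  \<open>\<parallel>\<psi> d - d\<parallel>\<^sup>2 = \<parallel>\<psi> d\<parallel>\<^sup>2 - \<parallel>d\<parallel>\<^sup>2 \<le> 0\<close>, and \<open>d = 0\<close> as \<open>1 - \<psi>\<close> has no zeros.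
\<close>

lemma cyclic_one_minus:
  assumes \<psi>: "\<And>A. finite A \<Longrightarrow> psd_on A (\<lambda>x y. k x y * (1 - \<psi> x * cnj (\<psi> y)))"
    and nz: "\<And>x. 1 - \<psi> x \<noteq> 0"
  shows "cyclic_mult H ip (\<lambda>x. 1 - \<psi> x)"
proof -
  have \<psi>m: "(\<lambda>x. \<psi> x * u x) \<in> H" "nsq (\<lambda>x. \<psi> x * u x) \<le> nsq u" if "u \<in> H" for u
    using mult_criterion[of 1 \<psi> u] \<psi> that by auto
  have om: "(\<lambda>x. (1 - \<psi> x) * u x) \<in> H" if "u \<in> H" for u
    using diff_mem[OF that \<psi>m(1)[OF that]] by (simp add: left_diff_distrib)
  have "\<exists>u\<in>H. hnorm ip (\<lambda>x. v x - (1 - \<psi> x) * u x) < e" if v: "v \<in> H" and e: "0 < e" for v e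
  proof -
    define T where "T u = (\<lambda>x. (1 - \<psi> x) * u x)" for u :: "'a \<Rightarrow> complex"
    have TH: "T u \<in> H" if "u \<in> H" for u unfolding T_def using om that .
    define R where "R = {(T u, ip (T u) v) | u. u \<in> H}"
    obtain w where w: "w \<in> H" "\<And>g l. (g, l) \<in> R \<Longrightarrow> l = ip g w"
      and approx: "\<And>e. 0 < e \<Longrightarrow> \<exists>(g, l)\<in>R. hnorm ip (\<lambda>x. g x - w x) < e"
    proof (rule bounded_graph_functional[of R "nsq v"])
      show "R \<noteq> {}" using zero_mem by (auto simp: R_def)
      show "g \<in> H" if "(g, l) \<in> R" for g l using that TH by (auto simp: R_def)
      show "(\<lambda>x. g x + g' x, l + l') \<in> R" if gl: "(g, l) \<in> R" "(g', l') \<in> R" for g l g' l'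
      proof -
        obtain u u' where u: "u \<in> H" "g = T u" "l = ip (T u) v" and u': "u' \<in> H" "g' = T u'" "l' = ip (T u') v"
          using gl by (auto simp: R_def)
        have T: "(\<lambda>x. g x + g' x) = T (\<lambda>x. u x + u' x)" by (simp add: u u' T_def algebra_simps)
        have "l + l' = ip (\<lambda>x. g x + g' x) v"
          using u u' TH v by (simp add: ip_add)
        then show ?thesis unfolding T R_def using u(1) u'(1) add_mem by blast
      qed
      show "(\<lambda>x. c * g x, c * l) \<in> R" if gl: "(g, l) \<in> R" for g l c
      proof -
        obtain u where u: "u \<in> H" "g = T u" "l = ip (T u) v" using gl by (auto simp: R_def)
        have T: "(\<lambda>x. c * g x) = T (\<lambda>x. c * u x)" by (simp add: u T_def algebra_simps)
        have "c * l = ip (\<lambda>x. c * g x) v" using u TH v by (simp add: ip_scale)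
        then show ?thesis unfolding T R_def using u(1) scale_mem by blast
      qed
      show "2 * Re l \<le> nsq v + nsq g" if gl: "(g, l) \<in> R" for g l
        using gl two_Re_ip_le[OF TH v] by (auto simp: R_def add.commute)
    qed blast
    define d where "d = (\<lambda>x. v x - w x)"
    have dH: "d \<in> H" unfolding d_def using v w(1) diff_mem by blast
    have "ip (T d) v = ip (T d) w" using w(2)[of "T d" "ip (T d) v"] dH by (auto simp: R_def)
    then have "ip (T d) d = 0"
      using ip_diff_right[OF v w(1) TH[OF dH]] by (simp add: d_def[symmetric])
    moreover have "T d = (\<lambda>x. d x - \<psi> x * d x)" by (simp add: T_def left_diff_distrib)
    ultimately have "nsq d = Re (ip (\<lambda>x. \<psi> x * d x) d)"
      using ip_diff[OF dH \<psi>m(1)[OF dH] dH] by (simp add: nsq_def)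
    then have "nsq (\<lambda>x. \<psi> x * d x - d x) \<le> 0"
      using nsq_diff[OF \<psi>m(1)[OF dH] dH] \<psi>m(2)[OF dH] by simp
    then have "nsq (\<lambda>x. \<psi> x * d x - d x) = 0"
      using nsq_ge_0[OF diff_mem[OF \<psi>m(1)[OF dH] dH]] by simp
    then have "(\<lambda>x. \<psi> x * d x - d x) = (\<lambda>x. 0)"
      using nsq_eq_0[OF diff_mem[OF \<psi>m(1)[OF dH] dH]] by simp
    then have "\<psi> x * d x - d x = 0" for x by (rule fun_cong)
    then have "(1 - \<psi> x) * d x = 0" for x by (simp add: left_diff_distrib)
    then have "d x = 0" for x using nz by simp
    then have vw: "w = v" by (auto simp: d_def fun_eq_iff)
    obtain u where u: "u \<in> H" "hnorm ip (\<lambda>x. T u x - v x) < e"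
      using approx[OF e] unfolding vw R_def by auto
    have "hnorm ip (\<lambda>x. v x - T u x) = hnorm ip (\<lambda>x. T u x - v x)"
      using hnorm_scale[OF diff_mem[OF TH[OF u(1)] v], of "-1"] by simp
    then show ?thesis using u by (intro bexI[of _ u]) (simp_all add: T_def)
  qed
  moreover have "(\<lambda>x. 1 - \<psi> x) \<in> Mult H" using om by (simp add: Mult_def)
  ultimately show ?thesis unfolding cyclic_mult_def by blast
qed

end

theorem theorem1p1:
  fixes H :: "('x \<Rightarrow> complex) set"
    and ip :: "('x \<Rightarrow> complex) \<Rightarrow> ('x \<Rightarrow> complex) \<Rightarrow> complex"
    and k :: "'x \<Rightarrow> 'x \<Rightarrow> complex"
    and x0 :: 'x
  assumes "rkhs H ip k"
    and "complete_pick H ip k"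
    and "normalized_at k x0"
  shows "(\<forall>f\<in>H. hnorm ip f \<le> 1 \<longrightarrow>
            (\<exists>\<phi>\<in>Mult H. \<exists>\<psi>\<in>Mult H.
               mult_norm H ip \<phi> \<le> 1 \<and> mult_norm H ip \<psi> \<le> 1 \<and> \<psi> x0 = 0 \<and>
               (\<forall>x. 1 - \<psi> x \<noteq> 0) \<and> f = (\<lambda>x. \<phi> x / (1 - \<psi> x))))
         \<and> H \<subseteq> smirnov H ip"
proof -
  interpret normalized_complete_pick H ip k x0
    using assms by (simp add: normalized_complete_pick_def normalized_complete_pick_axioms_def)
  show ?thesis
  proof (intro conjI ballI impI subsetI)
    fix f assume f: "f \<in> H" and f1: "hnorm ip f \<le> 1"
    define r where "r = hnorm ip f"
    have r: "0 \<le> 1 - r\<^sup>2" "0 \<le> r\<^sup>2"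
      using f1 hnorm_ge_0[OF f] by (auto simp: r_def power_le_one)
    obtain \<phi> \<psi> where \<phi>: "\<And>A. finite A \<Longrightarrow> psd_on A (\<lambda>x y. k x y * (1 - \<phi> x * cnj (\<phi> y)))"
      and \<psi>: "\<And>A. finite A \<Longrightarrow> psd_on A (\<lambda>x y. k x y * (1 - \<psi> x * cnj (\<psi> y)))"
      and *: "\<psi> x0 = 0" "\<And>x. 1 - \<psi> x \<noteq> 0" "f = (\<lambda>x. of_real (hnorm ip f) * \<phi> x / (1 - \<psi> x))"
      using contractive_quotient[OF f] by blast
    define \<phi>' where "\<phi>' x = of_real r * \<phi> x" for x
    have \<phi>': "psd_on A (\<lambda>x y. k x y * (1 - \<phi>' x * cnj (\<phi>' y)))" if "finite A" for A
    proof (rule psd_on_cong)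
      show "psd_on A (\<lambda>x y. of_real (1 - r\<^sup>2) * k x y
          + of_real (r\<^sup>2) * (k x y * (1 - \<phi> x * cnj (\<phi> y))))"
        by (intro psd_on_add psd_on_scale psd_on_kernel \<phi> that r)
    qed (simp add: \<phi>'_def algebra_simps power2_eq_square)
    show "\<exists>\<phi>\<in>Mult H. \<exists>\<psi>\<in>Mult H. mult_norm H ip \<phi> \<le> 1 \<and> mult_norm H ip \<psi> \<le> 1 \<and>
        \<psi> x0 = 0 \<and> (\<forall>x. 1 - \<psi> x \<noteq> 0) \<and> f = (\<lambda>x. \<phi> x / (1 - \<psi> x))"
    proof (intro bexI conjI)
      show "f = (\<lambda>x. \<phi>' x / (1 - \<psi> x))" unfolding \<phi>'_def r_def by (rule *(3))
    qed (use mult_criterion_contractive[OF \<phi>'] mult_criterion_contractive[OF \<psi>] *(1,2) in auto)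
  next
    fix f assume f: "f \<in> H"
    obtain \<phi> \<psi> where \<phi>: "\<And>A. finite A \<Longrightarrow> psd_on A (\<lambda>x y. k x y * (1 - \<phi> x * cnj (\<phi> y)))"
      and \<psi>: "\<And>A. finite A \<Longrightarrow> psd_on A (\<lambda>x y. k x y * (1 - \<psi> x * cnj (\<psi> y)))"
      and *: "\<psi> x0 = 0" "\<And>x. 1 - \<psi> x \<noteq> 0" "f = (\<lambda>x. of_real (hnorm ip f) * \<phi> x / (1 - \<psi> x))"
      using contractive_quotient[OF f] by blast
    define \<phi>' where "\<phi>' x = of_real (hnorm ip f) * \<phi> x" for x
    have "(\<lambda>x. \<phi>' x * g x) \<in> H" if "g \<in> H" for g
    proof -
      have "(\<lambda>x. \<phi> x * g x) \<in> H"
        using mult_criterion_contractive(1)[OF \<phi>] that by (simp add: Mult_def)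
      from scale_mem[OF this] show ?thesis by (simp only: \<phi>'_def mult.assoc)
    qed
    then have "\<phi>' \<in> Mult H" by (simp add: Mult_def)
    moreover have "cyclic_mult H ip (\<lambda>x. 1 - \<psi> x)" by (rule cyclic_one_minus[OF \<psi> *(2)])
    moreover have "f = (\<lambda>x. \<phi>' x / (1 - \<psi> x))" unfolding \<phi>'_def by (rule *(3))
    ultimately show "f \<in> smirnov H ip"
      unfolding smirnov_def by (intro CollectI exI[of _ \<phi>'] exI[of _ "\<lambda>x. 1 - \<psi> x"]) simp
  qed
qed

end
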